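(* Given $d\in\mathbb{N}$ and $C>0$, there exists a constant $C_0=C_0(d,C)>0$ such that the entropy numbers of $\mathcal{GB}_d(C)$ with respect to the $L^\infty$-norm on $[0,1]^d$ satisfy $$M_{\mathcal{GB}_d(C),L^\infty}(\varepsilon)\;\leq\; C_0\cdot\varepsilon^{-1/(\frac12+\frac1d)}\cdot\bigl(1+\ln(1/\varepsilon)\bigr)\qquad\text{for all }\varepsilon\in(0,1).$$
   Context: $\mathcal{GB}_d(C)$ is the set of general Barron functions with constant $C$: all functions $f:[0,1]^d\to\mathbb{R}$ for which there exist a complex measure $\mu$ on $\mathbb{R}^d$ and some $c\in[-C,C]$ with $$f(x)=c+\int_{\mathbb{R}^d}\bigl(e^{2\pi i\langle x,\xi\rangle}-1\bigr)\,d\mu(\xi)\ \text{ for all }x\in[0,1]^d,\qquad \int_{\mathbb{R}^d}|\xi|\,d|\mu|(\xi)\leq C,$$ where $|\mu|$ is the total variation measure of $\mu$. Packing entropy: for a nonempty subset $K$ of a metric space with metric $\mathrm{dist}$ and $\varepsilon>0$, an $\varepsilon$-packing set in $K$ is a set $N\subset K$ with $\mathrm{dist}(x_1,x_2)>\varepsilon$ for all distinct $x_1,x_2\in N$. $M_{K,\mathrm{dist}}(\varepsilon)$ is the natural logarithm of the maximal cardinality of an $\varepsilon$-packing set in $K$. Here $\mathrm{dist}$ is the metric induced by $\|\cdot\|_{L^\infty([0,1]^d)}$. *)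

theory Defs
  imports "HOL-Analysis.Analysis" "HOL-Probability.Essential_Supremum" "HOL-Library.Extended_Nat"
begin

section \<open>Complex measures\<close>

text \<open>A complex measure is a set function on the \<open>\<sigma>\<close>-algebra of \<open>M\<close>; only \<open>space M\<close> and
  \<open>sets M\<close> are used, not the measure carried by \<open>M\<close>. Since the values are complex numbers,
  countable additivity forces the total variation to be finite.\<close>

definition complex_measure :: "'a measure \<Rightarrow> ('a set \<Rightarrow> complex) \<Rightarrow> bool" where
  "complex_measure M \<mu> \<longleftrightarrow>
     \<mu> {} = 0 \<and>
     (\<forall>A :: nat \<Rightarrow> 'a set. range A \<subseteq> sets M \<longrightarrow> disjoint_family A \<longrightarrow>
        (\<lambda>n. \<mu> (A n)) sums \<mu> (\<Union>n. A n))"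

definition total_variation :: "'a measure \<Rightarrow> ('a set \<Rightarrow> complex) \<Rightarrow> 'a measure" where
  "total_variation M \<mu> =
     measure_of (space M) (sets M)
       (\<lambda>A. SUP E \<in> {E :: nat \<Rightarrow> 'a set. range E \<subseteq> sets M \<and> disjoint_family E \<and> (\<Union>n. E n) = A}.
              (\<Sum>n. ennreal (norm (\<mu> (E n)))))"

text \<open>The positive part in the Jordan decomposition of a finite signed measure \<open>\<nu>\<close>. The
  coercion \<^const>\<open>ennreal\<close> sends negative numbers to \<open>0\<close>, which does not affect the supremum,
  as \<open>\<nu> {} = 0\<close>. The negative part of \<open>\<nu>\<close> is the positive part of \<open>- \<nu>\<close>.\<close>

definition positive_variation :: "'a measure \<Rightarrow> ('a set \<Rightarrow> real) \<Rightarrow> 'a measure" where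
  "positive_variation M \<nu> =
     measure_of (space M) (sets M) (\<lambda>A. SUP B \<in> {B \<in> sets M. B \<subseteq> A}. ennreal (\<nu> B))"

definition signed_integral :: "'a measure \<Rightarrow> ('a set \<Rightarrow> real) \<Rightarrow> ('a \<Rightarrow> complex) \<Rightarrow> complex" where
  "signed_integral M \<nu> f =
     (\<integral>x. f x \<partial>positive_variation M \<nu>) - (\<integral>x. f x \<partial>positive_variation M (\<lambda>A. - \<nu> A))"

definition complex_measure_integral ::
    "'a measure \<Rightarrow> ('a set \<Rightarrow> complex) \<Rightarrow> ('a \<Rightarrow> complex) \<Rightarrow> complex" where
  "complex_measure_integral M \<mu> f =
     signed_integral M (\<lambda>A. Re (\<mu> A)) f + \<i> * signed_integral M (\<lambda>A. Im (\<mu> A)) f"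

section \<open>General Barron functions\<close>

text \<open>Functions on the cube \<open>cbox 0 1 = [0,1]\<^sup>d\<close>, where \<open>d = CARD('n)\<close>, are represented as
  extensional functions (equal to \<^const>\<open>undefined\<close> off the cube).\<close>

definition general_barron :: "real \<Rightarrow> (real ^ 'n \<Rightarrow> real) set" where
  "general_barron C =
     {f \<in> cbox 0 1 \<rightarrow>\<^sub>E UNIV. \<exists>\<mu> :: (real ^ 'n) set \<Rightarrow> complex. \<exists>c :: real.
        complex_measure borel \<mu> \<and>
        c \<in> {- C..C} \<and>
        (\<forall>x \<in> cbox 0 1.
           complex_of_real (f x) =
             of_real c + complex_measure_integral borel \<mu>
               (\<lambda>\<xi>. exp (2 * of_real pi * \<i> * of_real (x \<bullet> \<xi>)) - 1)) \<and>
        (\<integral>\<^sup>+ \<xi>. ennreal (norm \<xi>) \<partial>total_variation borel \<mu>) \<le> ennreal C}"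

text \<open>The value is \<open>\<infinity>\<close> if \<open>f - g\<close> is not measurable or not essentially bounded on the cube.\<close>

definition Linf_dist :: "(real ^ 'n \<Rightarrow> real) \<Rightarrow> (real ^ 'n \<Rightarrow> real) \<Rightarrow> ereal" where
  "Linf_dist f g = esssup (lebesgue_on (cbox 0 1)) (\<lambda>x. ereal \<bar>f x - g x\<bar>)"

section \<open>Packing entropy\<close>

definition packing_set :: "'a set \<Rightarrow> ('a \<Rightarrow> 'a \<Rightarrow> ereal) \<Rightarrow> real \<Rightarrow> 'a set \<Rightarrow> bool" where
  "packing_set K D \<epsilon> N \<longleftrightarrow>
     N \<subseteq> K \<and> (\<forall>x1 \<in> N. \<forall>x2 \<in> N. x1 \<noteq> x2 \<longrightarrow> D x1 x2 > ereal \<epsilon>)"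

text \<open>A nonempty set of extended naturals that is bounded by a natural number attains its supremum,
  so a finite packing number is the maximal cardinality; it is \<open>\<infinity>\<close> if there are
  infinite or arbitrarily large finite packing sets.\<close>

definition packing_number :: "'a set \<Rightarrow> ('a \<Rightarrow> 'a \<Rightarrow> ereal) \<Rightarrow> real \<Rightarrow> enat" where
  "packing_number K D \<epsilon> =
     (SUP N \<in> {N. packing_set K D \<epsilon> N}. if finite N then enat (card N) else \<infinity>)"

definition packing_entropy :: "'a set \<Rightarrow> ('a \<Rightarrow> 'a \<Rightarrow> ereal) \<Rightarrow> real \<Rightarrow> ereal" where
  "packing_entropy K D \<epsilon> =
     (case packing_number K D \<epsilon> of enat n \<Rightarrow> ereal (ln (real n)) | \<infinity> \<Rightarrow> \<infinity>)"

end

theory Submission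
  imports Defs
begin

text \<open>Write \<open>\<xi> = k + \<theta>\<close> with \<open>k\<close> the nearest lattice point. Taylor expansion in \<open>x \<bullet> \<theta>\<close> puts
  every general Barron function, up to a constant factor, into the weighted \<open>\<ell>\<^sup>1\<close> hull of the functions
  \<open>cos (2\<pi> x \<bullet> k + m\<pi>/2) \<cdot> x\<^bsub>j1\<^esub> \<dots> x\<^bsub>jm\<^esub>\<close> with weight \<open>(1 + \<bar>k\<bar>)(2d)\<^sup>m\<close>; at most \<open>O(r\<^sup>d)\<close> of
  them have weight \<open>\<le> r\<close>. Round all coefficients randomly to multiples of \<open>\<delta> = R\<^bsup>-(d+1)\<^esup>\<close>. The variance at
  a point is at most \<open>\<Sum> min (\<delta>\<^sup>2) (\<delta>\<bar>a\<bar>)\<close>, and splitting at weight \<open>R\<close> bounds this by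
  \<open>O(R\<^bsup>-(d+2)\<^esup>)\<close>; exponential moments over a grid then give a uniform error
  \<open>O(sqrt (ln (1/\<epsilon>)) R\<^bsup>-(d+2)/2\<^esup>)\<close>. The rounded coefficient vectors are integer vectors with
  \<open>\<Sum> w \<bar>b\<bar> = O(R\<^bsup>d+1\<^esup>)\<close>, and a generating function bound as for partitions shows that there are
  only \<open>exp (O(R\<^sup>d))\<close> of them. Take \<open>R\<^sup>d\<close> of order \<open>\<epsilon>\<^bsup>-2d/(d+2)\<^esup> (1 + ln (1/\<epsilon>))\<close>.\<close>

section \<open>Variation measures\<close>

text \<open>The only control on the measure is its first moment, so frequencies are unbounded and
  any cut-off must grow with the accuracy. Hence atoms are counted by weight: \<open>K\<close> and
  \<open>M\<close> only make the sums finite, and neither the norm bound nor the counts depend on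
  them. Unit lattice spacing suffices because on the cube the remaining phase is bounded by a
  dimensional constant, so the Taylor series converges factorially. For deterministic rounding the
  same split by weight only bounds the error by a multiple of \<open>1 / R\<close>. Cancellation of
  independent centred errors improves this, up to the logarithm, to \<open>R\<close> to the power
  \<open>- d * (1/2 + 1/d)\<close>; as the entropy has order \<open>R ^ d\<close>, this is where the
  exponent \<open>1/2 + 1/d\<close> comes from. The vector count costs no logarithm, so the
  logarithm in the bound stems from the union over the grid alone. Values on a grid are enough
  because the weight of an atom also dominates its Lipschitz constant.\<close>

definition partition_variation :: "'a measure \<Rightarrow> ('a set \<Rightarrow> complex) \<Rightarrow> 'a set \<Rightarrow> ennreal" where
  "partition_variation M \<mu> A =
     (SUP E \<in> {E :: nat \<Rightarrow> 'a set. range E \<subseteq> sets M \<and> disjoint_family E \<and> (\<Union>n. E n) = A}.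
        (\<Sum>n. ennreal (norm (\<mu> (E n)))))"

lemma ennreal_norm_le_suminf:
  fixes g :: "nat \<Rightarrow> 'b::banach"
  assumes "g sums s"
  shows "ennreal (norm s) \<le> (\<Sum>n. ennreal (norm (g n)))"
proof (cases "summable (\<lambda>n. norm (g n))")
  case True
  then have "norm s \<le> (\<Sum>n. norm (g n))"
    using summable_norm[OF True] sums_unique[OF assms] by simp
  then have "ennreal (norm s) \<le> ennreal (\<Sum>n. norm (g n))"
    by (rule ennreal_leI)
  also have "\<dots> = (\<Sum>n. ennreal (norm (g n)))"
    by (rule suminf_ennreal2[symmetric]) (use True in auto)
  finally show ?thesis .
next
  case False
  then have "(\<Sum>n. ennreal (norm (g n))) = top"
    using summable_suminf_not_top[of "\<lambda>n. norm (g n)"] norm_ge_zero by blast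
  then show ?thesis by simp
qed

lemma suminf_swap_ennreal:
  fixes f :: "nat \<Rightarrow> nat \<Rightarrow> ennreal"
  shows "(\<Sum>i. \<Sum>n. f i n) = (\<Sum>n. \<Sum>i. f i n)"
  using nn_integral_suminf[of "\<lambda>i n. f i n" "count_space UNIV"]
  by (simp add: nn_integral_count_space_nat)

lemma partition_variation_upper:
  assumes "range E \<subseteq> sets M" "disjoint_family E" "(\<Union>n. E n) = A"
  shows "(\<Sum>n. ennreal (norm (\<mu> (E n)))) \<le> partition_variation M \<mu> A"
  unfolding partition_variation_def using assms by (intro SUP_upper) auto

lemma norm_le_partition_variation:
  assumes \<mu>: "complex_measure M \<mu>" and B: "B \<in> sets M" and A: "A \<in> sets M" and "B \<subseteq> A"
  shows "ennreal (norm (\<mu> B)) \<le> partition_variation M \<mu> A"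
proof -
  define E where "E = (\<lambda>n::nat. if n = 0 then B else if n = 1 then A - B else {})"
  have "ennreal (norm (\<mu> B)) = (\<Sum>n\<in>{0}. ennreal (norm (\<mu> (E n))))"
    by (simp add: E_def)
  also have "\<dots> \<le> (\<Sum>n. ennreal (norm (\<mu> (E n))))"
    by (rule sum_le_suminf) auto
  also have "\<dots> \<le> partition_variation M \<mu> A"
  proof (rule partition_variation_upper)
    show "range E \<subseteq> sets M" using A B by (auto simp: E_def)
    show "disjoint_family E" by (auto simp: E_def disjoint_family_on_def)
    have "E 0 \<union> E 1 = A" using \<open>B \<subseteq> A\<close> by (auto simp: E_def)
    moreover have "E n \<subseteq> A" for n using \<open>B \<subseteq> A\<close> by (auto simp: E_def)
    ultimately show "(\<Union>n. E n) = A" by blast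
  qed
  finally show ?thesis .
qed

lemma partition_variation_mono:
  assumes A: "A \<in> sets M" and B: "B \<in> sets M" and "A \<subseteq> B"
  shows "partition_variation M \<mu> A \<le> partition_variation M \<mu> B"
  unfolding partition_variation_def[of M \<mu> A]
proof (rule SUP_least, clarify)
  fix E :: "nat \<Rightarrow> 'a set"
  assume E: "range E \<subseteq> sets M" "disjoint_family E" "A = (\<Union>n. E n)"
  define F where "F = (\<lambda>n. case n of 0 \<Rightarrow> B - A | Suc n \<Rightarrow> E n)"
  have F: "F 0 = B - A" "\<And>n. F (Suc n) = E n" by (auto simp: F_def)
  have "(\<Sum>n. ennreal (norm (\<mu> (E n)))) \<le> (\<Sum>n. ennreal (norm (\<mu> (F n))))"
  proof (rule suminf_le_const)
    fix n
    have "(\<Sum>i<n. ennreal (norm (\<mu> (E i)))) \<le> (\<Sum>i<Suc n. ennreal (norm (\<mu> (F i))))"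
      by (subst sum.lessThan_Suc_shift) (simp add: F)
    also have "\<dots> \<le> (\<Sum>i. ennreal (norm (\<mu> (F i))))"
      by (rule sum_le_suminf) auto
    finally show "(\<Sum>i<n. ennreal (norm (\<mu> (E i)))) \<le> (\<Sum>i. ennreal (norm (\<mu> (F i))))" .
  qed simp
  also have "\<dots> \<le> partition_variation M \<mu> B"
  proof (rule partition_variation_upper)
    show "range F \<subseteq> sets M" using E A B by (auto simp: F_def split: nat.split)
    have "F m \<inter> F n = {}" if "m \<noteq> n" for m n
    proof (cases m; cases n)
      fix i j assume "m = Suc i" "n = Suc j"
      then show ?thesis using E(2) that by (auto simp: F disjoint_family_on_def)
    qed (use that E(3) in \<open>auto simp: F\<close>)
    then show "disjoint_family F" by (auto simp: disjoint_family_on_def)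
    show "(\<Union>n. F n) = B"
    proof (intro equalityI subsetI)
      fix x assume "x \<in> (\<Union>n. F n)"
      then obtain n where "x \<in> F n" by blast
      then show "x \<in> B" using E(3) \<open>A \<subseteq> B\<close> by (cases n) (auto simp: F)
    next
      fix x assume x: "x \<in> B"
      show "x \<in> (\<Union>n. F n)"
      proof (cases "x \<in> A")
        case True
        then obtain n where "x \<in> E n" using E(3) by blast
        then show ?thesis using F(2) by blast
      qed (use x F(1) in blast)
    qed
  qed
  finally show "(\<Sum>n. ennreal (norm (\<mu> (E n)))) \<le> partition_variation M \<mu> B" .
qed

text \<open>For one inequality, near-optimal partitions of the pieces are glued to a partition of
  the union. For the other, a partition of the union is refined by the pieces; additivity and the
  triangle inequality show that refining can only increase the sum.\<close>

lemma partition_variation_UN: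
  assumes \<mu>: "complex_measure M \<mu>" and A: "range A \<subseteq> sets M" and disj: "disjoint_family A"
  shows "(\<Sum>n. partition_variation M \<mu> (A n)) = partition_variation M \<mu> (\<Union>n. A n)"
proof (rule antisym)
  let ?v = "partition_variation M \<mu>" and ?U = "\<Union>n::nat. A n"
  have U: "?U \<in> sets M" using A by auto
  show "(\<Sum>n. ?v (A n)) \<le> ?v ?U"
  \<comment> \<open>Only a union of finite variation matters. By monotonicity its pieces then have
    finite variation too, so the \<open>n\<close>-th piece has a partition that is optimal up to
    \<open>e * (1/2) ^ Suc n\<close>, and these errors sum to \<open>e\<close>.\<close>
  proof (rule ennreal_le_epsilon)
    fix e :: real assume fin: "?v ?U < top" and e: "0 < e"
    have "\<exists>E. range E \<subseteq> sets M \<and> disjoint_family E \<and> (\<Union>i. E i) = A n \<and>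
        ?v (A n) \<le> (\<Sum>i. ennreal (norm (\<mu> (E i)))) + e * (1/2) ^ Suc n" for n
    proof -
      let ?P = "{E :: nat \<Rightarrow> 'a set. range E \<subseteq> sets M \<and> disjoint_family E \<and> (\<Union>i. E i) = A n}"
      have ne: "?P \<noteq> {}"
      proof -
        have "(\<lambda>i. if i = 0 then A n else {}) \<in> ?P"
          using A by (auto simp: disjoint_family_on_def split: if_splits)
        then show ?thesis by blast
      qed
      have "?v (A n) \<le> ?v ?U"
        using A U by (intro partition_variation_mono) auto
      then have "?v (A n) \<noteq> \<infinity>" using fin by auto
      then have "\<exists>E\<in>?P. ?v (A n) < (\<Sum>i. ennreal (norm (\<mu> (E i)))) + e * (1/2) ^ Suc n"
        using e ne by (intro SUP_approx_ennreal) (auto simp: partition_variation_def)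
      then obtain E where E: "E \<in> ?P"
        "?v (A n) < (\<Sum>i. ennreal (norm (\<mu> (E i)))) + e * (1/2) ^ Suc n" ..
      show ?thesis
        using E(1) less_imp_le[OF E(2)] by blast
    qed
    then obtain E where E: "\<And>n. range (E n) \<subseteq> sets M" "\<And>n. disjoint_family (E n)"
        "\<And>n. (\<Union>i. E n i) = A n"
        "\<And>n. ?v (A n) \<le> (\<Sum>i. ennreal (norm (\<mu> (E n i)))) + e * (1/2) ^ Suc n"
      by metis
    define F where "F k = E (fst (prod_decode k)) (snd (prod_decode k))" for k
    have EA: "E n i \<subseteq> A n" for n i using E(3) by blast
    have "(\<Sum>n. ?v (A n)) \<le> (\<Sum>n. (\<Sum>i. ennreal (norm (\<mu> (E n i)))) + e * (1/2) ^ Suc n)"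
      using E(4) by (intro suminf_le) auto
    also have "\<dots> = (\<Sum>n. \<Sum>i. ennreal (norm (\<mu> (E n i)))) + (\<Sum>n. ennreal e * ennreal ((1/2) ^ Suc n))"
      using e by (subst suminf_add[symmetric])
        (auto simp del: ennreal_suminf_cmult simp add: ennreal_mult[symmetric])
    also have "(\<Sum>n. ennreal e * ennreal ((1/2) ^ Suc n)) = e"
      unfolding ennreal_suminf_cmult
      by (subst suminf_ennreal_eq[OF zero_le_power power_half_series]) auto
    also have "(\<Sum>n. \<Sum>i. ennreal (norm (\<mu> (E n i)))) = (\<Sum>k. ennreal (norm (\<mu> (F k))))"
      unfolding F_def
      by (rule suminf_ennreal_2dimen[symmetric, where f = "\<lambda>(n, i). ennreal (norm (\<mu> (E n i)))",
            unfolded split_beta]) auto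
    also have "\<dots> \<le> ?v ?U"
    proof (rule partition_variation_upper)
      show "range F \<subseteq> sets M" using E(1) by (auto simp: F_def)
      show "disjoint_family F"
        unfolding disjoint_family_on_def
      proof (intro ballI impI)
        fix k l :: nat assume "k \<noteq> l"
        then have ne: "prod_decode k \<noteq> prod_decode l" by simp
        show "F k \<inter> F l = {}"
        proof (cases "fst (prod_decode k) = fst (prod_decode l)")
          case True
          then have "snd (prod_decode k) \<noteq> snd (prod_decode l)" using ne by (auto simp: prod_eq_iff)
          then show ?thesis using E(2) True by (auto simp: F_def disjoint_family_on_def)
        next
          case False
          then have "A (fst (prod_decode k)) \<inter> A (fst (prod_decode l)) = {}"
            using disj by (auto simp: disjoint_family_on_def)
          then show ?thesis using EA unfolding F_def by blast
        qed
      qed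
      show "(\<Union>k. F k) = ?U"
      proof (intro equalityI subsetI)
        fix x assume "x \<in> ?U"
        then obtain n i where "x \<in> E n i" using E(3) by blast
        then have "x \<in> F (prod_encode (n, i))" by (simp add: F_def)
        then show "x \<in> (\<Union>k. F k)" by blast
      qed (use EA in \<open>auto simp: F_def\<close>)
    qed
    finally show "(\<Sum>n. ?v (A n)) \<le> ?v ?U + e" by (simp add: add_right_mono)
  qed
  show "?v ?U \<le> (\<Sum>n. ?v (A n))"
    unfolding partition_variation_def[of M \<mu> ?U]
  proof (rule SUP_least, clarify)
    fix E :: "nat \<Rightarrow> 'a set"
    assume E: "range E \<subseteq> sets M" "disjoint_family E" "(\<Union>n. E n) = ?U"
    have "(\<Sum>i. ennreal (norm (\<mu> (E i)))) \<le> (\<Sum>i. \<Sum>n. ennreal (norm (\<mu> (E i \<inter> A n))))"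
    proof (intro suminf_le ennreal_norm_le_suminf)
      fix i
      have "range (\<lambda>n. E i \<inter> A n) \<subseteq> sets M" using E(1) A by auto
      moreover have "disjoint_family (\<lambda>n. E i \<inter> A n)"
        using disj by (auto simp: disjoint_family_on_def)
      ultimately have "(\<lambda>n. \<mu> (E i \<inter> A n)) sums \<mu> (\<Union>n. E i \<inter> A n)"
        using \<mu> unfolding complex_measure_def by blast
      moreover have "(\<Union>n. E i \<inter> A n) = E i" using E(3) by blast
      ultimately show "(\<lambda>n. \<mu> (E i \<inter> A n)) sums \<mu> (E i)" by simp
    qed auto
    also have "\<dots> = (\<Sum>n. \<Sum>i. ennreal (norm (\<mu> (E i \<inter> A n))))"
      by (rule suminf_swap_ennreal)
    also have "\<dots> \<le> (\<Sum>n. ?v (A n))"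
    proof (intro suminf_le partition_variation_upper)
      fix n
      show "range (\<lambda>i. E i \<inter> A n) \<subseteq> sets M" using E(1) A by auto
      show "disjoint_family (\<lambda>i. E i \<inter> A n)" using E(2) by (auto simp: disjoint_family_on_def)
      show "(\<Union>i. E i \<inter> A n) = A n" using E(3) by blast
    qed auto
    finally show "(\<Sum>i. ennreal (norm (\<mu> (E i)))) \<le> (\<Sum>n. ?v (A n))" .
  qed
qed

text \<open>\<open>measure_of\<close> falls back to the null measure on a set function that is not
  countably additive, so additivity has to be known before any value can be read off.\<close>

lemma emeasure_total_variation:
  assumes \<mu>: "complex_measure M \<mu>" and A: "A \<in> sets M"
  shows "emeasure (total_variation M \<mu>) A = partition_variation M \<mu> A"
  unfolding total_variation_def partition_variation_def[symmetric]
proof (rule emeasure_measure_of_sigma)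
  show "sigma_algebra (space M) (sets M)" ..
  show "positive (sets M) (partition_variation M \<mu>)"
    unfolding positive_def partition_variation_def
  proof (intro antisym SUP_least)
    fix E :: "nat \<Rightarrow> 'a set"
    assume "E \<in> {E. range E \<subseteq> sets M \<and> disjoint_family E \<and> (\<Union>n. E n) = {}}"
    then have "\<And>n. E n = {}" by auto
    then show "(\<Sum>n. ennreal (norm (\<mu> (E n)))) \<le> 0" using \<mu> by (simp add: complex_measure_def)
  qed simp
  show "countably_additive (sets M) (partition_variation M \<mu>)"
    using partition_variation_UN[OF \<mu>] by (auto simp: countably_additive_def)
qed (fact A)

text \<open>If the defining supremum were not countably additive, then \<^const>\<open>positive_variation\<close> would be the
  null measure; hence no Jordan decomposition is needed here.\<close>

lemma nn_integral_positive_variation_le: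
  fixes \<nu> :: "'a set \<Rightarrow> real"
  assumes \<mu>: "complex_measure M \<mu>" and le: "\<And>A. \<nu> A \<le> norm (\<mu> A)"
  shows "(\<integral>\<^sup>+ x. f x \<partial>positive_variation M \<nu>) \<le> (\<integral>\<^sup>+ x. f x \<partial>total_variation M \<mu>)"
proof (rule nn_integral_mono_measure)
  show sets: "sets (positive_variation M \<nu>) = sets (total_variation M \<mu>)"
    by (simp add: positive_variation_def total_variation_def)
  show "positive_variation M \<nu> \<le> total_variation M \<mu>"
    unfolding le_measure[OF sets]
  proof
    fix A assume "A \<in> sets (positive_variation M \<nu>)"
    then have True: "A \<in> sets M" by (simp add: positive_variation_def)
    show "emeasure (positive_variation M \<nu>) A \<le> emeasure (total_variation M \<mu>) A"
    proof -
      have "emeasure (positive_variation M \<nu>) A \<le> (SUP B \<in> {B \<in> sets M. B \<subseteq> A}. ennreal (\<nu> B))"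
        unfolding positive_variation_def emeasure_measure_of_conv by auto
      also have "\<dots> \<le> partition_variation M \<mu> A"
      proof (rule SUP_least, clarify)
        fix B assume B: "B \<in> sets M" "B \<subseteq> A"
        have "ennreal (\<nu> B) \<le> ennreal (norm (\<mu> B))" by (intro ennreal_leI le)
        also have "\<dots> \<le> partition_variation M \<mu> A"
          by (rule norm_le_partition_variation[OF \<mu> B(1) True B(2)])
        finally show "ennreal (\<nu> B) \<le> partition_variation M \<mu> A" .
      qed
      finally show ?thesis by (simp add: emeasure_total_variation[OF \<mu> True])
    qed
  qed
qed

section \<open>Real form of the Fourier representation\<close>

text \<open>With the phase advanced by quarter turns, differentiation becomes an index shift, so
  cosine, sine and all their derivatives form one family.\<close>

definition wave :: "nat \<Rightarrow> real \<Rightarrow> real" where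
  "wave q t = cos (t + real q * (pi / 2))"

lemma wave_simps: "wave 0 t = cos t" "wave (Suc 0) t = - sin t"
  by (auto simp: wave_def cos_add)

lemma abs_wave_le_1: "\<bar>wave q t\<bar> \<le> 1"
  by (simp add: wave_def)

lemma wave_deriv: "(wave q has_real_derivative wave (Suc q) t) (at t)"
proof -
  have "(wave q has_real_derivative - sin (t + real q * (pi / 2))) (at t)"
    unfolding wave_def by (auto intro!: derivative_eq_intros)
  also have "- sin (t + real q * (pi / 2)) = wave (Suc q) t"
  proof -
    have eq: "t + real (Suc q) * (pi / 2) = (t + real q * (pi / 2)) + pi / 2" by (simp add: algebra_simps)
    show ?thesis unfolding wave_def eq by (simp add: minus_sin_cos_eq)
  qed
  finally show ?thesis .
qed

lemma wave_Lipschitz: "\<bar>wave q s - wave q t\<bar> \<le> \<bar>s - t\<bar>"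
proof -
  have "norm (wave q s - wave q t) \<le> 1 * norm (s - t)"
    by (rule field_differentiable_bound[of UNIV _ "wave (Suc q)"])
      (use wave_deriv abs_wave_le_1 in auto)
  then show ?thesis by simp
qed

lemma borel_measurable_wave [measurable]: "wave q \<in> borel_measurable borel"
  by (intro borel_measurable_continuous_onI continuous_at_imp_continuous_on ballI)
    (use wave_deriv DERIV_isCont in blast)

text \<open>The first moment is the only quantitative information on the variation measures; all
  integrands below are therefore dominated by a multiple of \<open>norm \<xi>\<close>.\<close>

lemma integrable_norm_bound:
  fixes h :: "'a::euclidean_space \<Rightarrow> 'b::{banach, second_countable_topology}"
  assumes sets: "sets N = sets borel" and fin: "(\<integral>\<^sup>+ \<xi>. ennreal (norm \<xi>) \<partial>N) \<le> ennreal C"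
    and h: "h \<in> borel_measurable borel" and le: "\<And>\<xi>. norm (h \<xi>) \<le> B * norm \<xi>"
  shows "integrable N h"
proof (rule Bochner_Integration.integrable_bound)
  have "integrable N (\<lambda>\<xi>. norm \<xi>)"
  proof (rule integrableI_bounded)
    show "(\<lambda>\<xi>. norm \<xi>) \<in> borel_measurable N"
      by (simp add: measurable_cong_sets[OF sets refl])
    have "(\<integral>\<^sup>+ \<xi>. ennreal (norm (norm \<xi>)) \<partial>N) \<le> ennreal C" using fin by simp
    also have "\<dots> < \<infinity>" by simp
    finally show "(\<integral>\<^sup>+ \<xi>. ennreal (norm (norm \<xi>)) \<partial>N) < \<infinity>" .
  qed
  then show "integrable N (\<lambda>\<xi>. B * norm \<xi>)" by simp
  show "h \<in> borel_measurable N" using h by (simp add: measurable_cong_sets[OF sets refl])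
  show "AE \<xi> in N. norm (h \<xi>) \<le> norm (B * norm \<xi>)"
    using le by (auto intro: order_trans[OF _ abs_ge_self])
qed

lemma abs_integral_le_norm_bound:
  fixes h :: "'a::euclidean_space \<Rightarrow> real"
  assumes sets: "sets N = sets borel" and fin: "(\<integral>\<^sup>+ \<xi>. ennreal (norm \<xi>) \<partial>N) \<le> ennreal C"
    and h: "h \<in> borel_measurable borel" and le: "\<And>\<xi>. \<bar>h \<xi>\<bar> \<le> B * norm \<xi>"
    and "0 \<le> B" "0 \<le> C"
  shows "\<bar>\<integral>\<xi>. h \<xi> \<partial>N\<bar> \<le> B * C"
proof -
  have int: "integrable N (\<lambda>\<xi>. norm \<xi>)"
    by (rule integrable_norm_bound[OF sets fin, where B = 1]) auto
  have "ennreal (\<integral>\<xi>. norm \<xi> \<partial>N) = (\<integral>\<^sup>+ \<xi>. ennreal (norm \<xi>) \<partial>N)"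
    by (rule nn_integral_eq_integral[OF int, symmetric]) simp
  then have "(\<integral>\<xi>. norm \<xi> \<partial>N) \<le> C"
    using fin \<open>0 \<le> C\<close> by (metis ennreal_le_iff)
  moreover have "\<bar>\<integral>\<xi>. h \<xi> \<partial>N\<bar> \<le> (\<integral>\<xi>. B * norm \<xi> \<partial>N)"
  proof -
    have "integrable N h"
      by (rule integrable_norm_bound[OF sets fin h, where B = B]) (use le in simp)
    then have "(\<integral>\<xi>. \<bar>h \<xi>\<bar> \<partial>N) \<le> (\<integral>\<xi>. B * norm \<xi> \<partial>N)"
      by (intro integral_mono) (use le int in auto)
    then show ?thesis using integral_abs_bound[of N h] by linarith
  qed
  ultimately show ?thesis
    using mult_left_mono[of "\<integral>\<xi>. norm \<xi> \<partial>N" C B] \<open>0 \<le> B\<close> by simp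
qed

lemma norm_cis_minus_1_le: "norm (exp (\<i> * of_real t) - 1) \<le> \<bar>t\<bar>"
proof -
  have "norm (exp (\<i> * of_real t) - 1) = 2 * \<bar>sin (t / 2)\<bar>"
    using dist_exp_i_1[of t] by simp
  then show ?thesis using abs_sin_le_one abs_sin_x_le_abs_x[of "t / 2"] by simp
qed

text \<open>On taking real parts, the real part of the measure meets \<open>cos t - 1\<close> and
  the imaginary part meets \<open>- sin t\<close>, which are waves 0 and 1 minus their values at 0.
  The index \<open>q\<close> selects real or imaginary part, \<open>s\<close> positive or negative
  variation; all four measures inherit the moment bound of the total variation.\<close>

lemma general_barron_real_form:
  fixes f :: "real ^ 'n::finite \<Rightarrow> real"
  assumes f: "f \<in> general_barron C" and "C > 0"
  obtains c and \<nu> :: "nat \<Rightarrow> nat \<Rightarrow> (real ^ 'n) measure" where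
    "\<bar>c\<bar> \<le> C" "\<And>q s. sets (\<nu> q s) = sets borel"
    "\<And>q s. (\<integral>\<^sup>+ \<xi>. ennreal (norm \<xi>) \<partial>\<nu> q s) \<le> ennreal C"
    "\<And>x. x \<in> cbox 0 1 \<Longrightarrow>
       f x = c + (\<Sum>q<2. \<Sum>s<2. (- 1) ^ s * (\<integral>\<xi>. wave q (2 * pi * (x \<bullet> \<xi>)) - wave q 0 \<partial>\<nu> q s))"
proof -
  obtain \<mu> :: "(real ^ 'n) set \<Rightarrow> complex" and c where
    \<mu>: "complex_measure borel \<mu>" and c: "c \<in> {- C..C}"
    and fx: "\<And>x. x \<in> cbox 0 1 \<Longrightarrow> complex_of_real (f x) = of_real c + complex_measure_integral borel \<mu>
               (\<lambda>\<xi>. exp (2 * of_real pi * \<i> * of_real (x \<bullet> \<xi>)) - 1)"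
    and tv: "(\<integral>\<^sup>+ \<xi>. ennreal (norm \<xi>) \<partial>total_variation borel \<mu>) \<le> ennreal C"
    using f unfolding general_barron_def by blast
  define part where "part q s A = (- 1) ^ s * (if q = 0 then Re (\<mu> A) else Im (\<mu> A))"
    for q s :: nat and A
  define \<nu> where "\<nu> q s = positive_variation borel (part q s)" for q s
  have part_le: "part q s A \<le> norm (\<mu> A)" for q s A
  proof -
    have "part q s A \<le> \<bar>part q s A\<bar>" by simp
    also have "\<dots> \<le> norm (\<mu> A)"
      by (simp add: part_def abs_mult power_abs abs_Re_le_cmod abs_Im_le_cmod)
    finally show ?thesis .
  qed
  have sets: "sets (\<nu> q s) = sets borel" for q s
    unfolding \<nu>_def positive_variation_def by (metis sets.sets_measure_of_eq)
  have fin: "(\<integral>\<^sup>+ \<xi>. ennreal (norm \<xi>) \<partial>\<nu> q s) \<le> ennreal C" for q s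
    using nn_integral_positive_variation_le[OF \<mu> part_le] tv unfolding \<nu>_def by (rule order_trans)
  have "f x = c + (\<Sum>q<2. \<Sum>s<2. (- 1) ^ s * (\<integral>\<xi>. wave q (2 * pi * (x \<bullet> \<xi>)) - wave q 0 \<partial>\<nu> q s))"
    if x: "x \<in> cbox 0 1" for x
  proof -
    define h where "h = (\<lambda>\<xi>. exp (2 * of_real pi * \<i> * of_real (x \<bullet> \<xi>)) - (1 :: complex))"
    have h_alt: "h \<xi> = exp (\<i> * of_real (2 * pi * (x \<bullet> \<xi>))) - 1" for \<xi>
      by (simp add: h_def mult_ac)
    have meas: "h \<in> borel_measurable borel" unfolding h_def by measurable
    have bound: "norm (h \<xi>) \<le> 2 * pi * norm x * norm \<xi>" for \<xi>
    proof -
      have "norm (h \<xi>) \<le> \<bar>2 * pi * (x \<bullet> \<xi>)\<bar>" unfolding h_alt by (rule norm_cis_minus_1_le)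
      also have "\<dots> \<le> 2 * pi * (norm x * norm \<xi>)"
        using Cauchy_Schwarz_ineq2[of x \<xi>] by (simp add: abs_mult)
      finally show ?thesis by (simp add: mult_ac)
    qed
    have int: "integrable (\<nu> q s) h" for q s
      by (rule integrable_norm_bound[OF sets fin meas bound])
    have Re_h: "Re (h \<xi>) = wave 0 (2 * pi * (x \<bullet> \<xi>)) - wave 0 0"
      and Im_h: "- Im (h \<xi>) = wave 1 (2 * pi * (x \<bullet> \<xi>)) - wave 1 0" for \<xi>
      by (simp_all add: h_alt wave_simps Re_exp Im_exp)
    have "complex_of_real (f x) = of_real c + (((\<integral>\<xi>. h \<xi> \<partial>\<nu> 0 0) - (\<integral>\<xi>. h \<xi> \<partial>\<nu> 0 1))
        + \<i> * ((\<integral>\<xi>. h \<xi> \<partial>\<nu> 1 0) - (\<integral>\<xi>. h \<xi> \<partial>\<nu> 1 1)))"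
      using fx[OF x] unfolding complex_measure_integral_def signed_integral_def h_def \<nu>_def part_def
      by simp
    from arg_cong[OF this, of Re]
    have "f x = c + ((Re (\<integral>\<xi>. h \<xi> \<partial>\<nu> 0 0) - Re (\<integral>\<xi>. h \<xi> \<partial>\<nu> 0 1))
        + (- Im (\<integral>\<xi>. h \<xi> \<partial>\<nu> 1 0) + Im (\<integral>\<xi>. h \<xi> \<partial>\<nu> 1 1)))"
      by simp
    moreover have "Re (\<integral>\<xi>. h \<xi> \<partial>\<nu> q s) = (\<integral>\<xi>. wave 0 (2 * pi * (x \<bullet> \<xi>)) - wave 0 0 \<partial>\<nu> q s)" for q s
      using integral_Re[OF int[of q s]] by (simp only: Re_h)
    moreover have "Im (\<integral>\<xi>. h \<xi> \<partial>\<nu> q s) = - (\<integral>\<xi>. wave 1 (2 * pi * (x \<bullet> \<xi>)) - wave 1 0 \<partial>\<nu> q s)" for q s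
    proof -
      have "- Im (\<integral>\<xi>. h \<xi> \<partial>\<nu> q s) = (\<integral>\<xi>. - Im (h \<xi>) \<partial>\<nu> q s)"
        using integral_Im[OF int[of q s]] by simp
      then show ?thesis unfolding Im_h by simp
    qed
    ultimately show ?thesis
      by (simp add: numeral_2_eq_2)
  qed
  then show ?thesis using that[of c \<nu>] c sets fin by auto
qed

section \<open>A lattice dictionary\<close>

lemma wave_Taylor:
  "\<bar>wave q (a + b) - (\<Sum>m<M. wave (q + m) a * b ^ m / fact m)\<bar> \<le> \<bar>b\<bar> ^ M / fact M"
proof -
  let ?d = "\<lambda>m t. wave (q + m) (a + t)"
  have "(?d m has_real_derivative ?d (Suc m) t) (at t)" for m t
  proof -
    have "((\<lambda>t. a + t) has_real_derivative 1) (at t)" by (auto intro!: derivative_eq_intros)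
    from DERIV_chain2[OF wave_deriv this, of "q + m"] show ?thesis by simp
  qed
  then have "\<forall>m t. (?d m has_real_derivative ?d (Suc m) t) (at t)" by blast
  from Maclaurin_all_le[OF refl this, of b M] obtain t where
    "wave q (a + b) = (\<Sum>m<M. wave (q + m) a / fact m * b ^ m) + wave (q + M) (a + t) / fact M * b ^ M"
    by auto
  then have "\<bar>wave q (a + b) - (\<Sum>m<M. wave (q + m) a * b ^ m / fact m)\<bar>
      = \<bar>wave (q + M) (a + t)\<bar> * (\<bar>b\<bar> ^ M / fact M)"
    by (simp add: abs_mult power_abs)
  also have "\<dots> \<le> 1 * (\<bar>b\<bar> ^ M / fact M)"
    by (intro mult_right_mono abs_wave_le_1) auto
  finally show ?thesis by simp
qed

lemma finite_lists_length_eq_UNIV: "finite {l :: 'n::finite list. length l = m}"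
  using finite_lists_length_eq[of "UNIV :: 'n set" m] by simp

lemma finite_lists_length_less: "finite {l :: 'n::finite list. length l < M}"
proof -
  have "{l :: 'n list. length l < M} = (\<Union>m<M. {l. length l = m})" by auto
  then show ?thesis by (simp add: finite_lists_length_eq_UNIV)
qed

lemma card_lists_length_UNIV: "card {l :: 'n::finite list. length l = m} = CARD('n) ^ m"
  using card_lists_length_eq[of "UNIV :: 'n set" m] by simp

lemma sum_lists_length_less:
  fixes F :: "'n::finite list \<Rightarrow> 'b::comm_monoid_add"
  shows "(\<Sum>l | length l < M. F l) = (\<Sum>m<M. \<Sum>l | length l = m. F l)"
proof (induction M)
  case (Suc M)
  have "{l :: 'n list. length l < Suc M} = {l. length l < M} \<union> {l. length l = M}" by auto
  then show ?case
    using Suc by (simp add: sum.union_disjoint finite_lists_length_less finite_lists_length_eq_UNIV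
        disjoint_iff)
qed simp

text \<open>Over words a power of a sum expands without multinomial coefficients; this is why
  monomials are indexed by lists instead of multi-indices.\<close>

lemma sum_lists_prod_list:
  fixes u :: "'n::finite \<Rightarrow> 'b::comm_ring_1"
  shows "(\<Sum>l | length l = m. prod_list (map u l)) = (\<Sum>j\<in>UNIV. u j) ^ m"
proof (induction m)
  case (Suc m)
  have eq: "{l :: 'n list. length l = Suc m} = (\<lambda>(j, l). j # l) ` (UNIV \<times> {l. length l = m})"
    by (auto simp: length_Suc_conv image_iff)
  have "(\<Sum>l | length l = Suc m. prod_list (map u l))
      = (\<Sum>(j, l)\<in>UNIV \<times> {l. length l = m}. u j * prod_list (map u l))"
    unfolding eq by (subst sum.reindex) (auto simp: inj_on_def split_def)
  also have "\<dots> = (\<Sum>j\<in>UNIV. u j) * (\<Sum>l | length l = m. prod_list (map u l))"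
    by (simp add: sum.cartesian_product[symmetric] sum_product)
  finally show ?case using Suc by simp
qed simp

lemma abs_prod_list: "\<bar>prod_list xs\<bar> = prod_list (map abs xs)" for xs :: "real list"
  by (induction xs) (auto simp: abs_mult)

lemma sum_exp_series_le: "0 \<le> y \<Longrightarrow> (\<Sum>m<M. y ^ m / fact m) \<le> exp y" for y :: real
  using Maclaurin_exp_le[of y M] by force

section \<open>Nearest lattice points, atoms and expansion coefficients\<close>

definition lattice_point :: "real ^ 'n \<Rightarrow> int ^ 'n" where
  "lattice_point \<xi> = (\<chi> j. round (\<xi> $ j))"

definition lattice_offset :: "real ^ 'n \<Rightarrow> 'n \<Rightarrow> real" where
  "lattice_offset \<xi> j = \<xi> $ j - of_int (lattice_point \<xi> $ j)"

definition lattice_norm :: "int ^ 'n \<Rightarrow> real" where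
  "lattice_norm k = of_int (Max (range (\<lambda>j. \<bar>k $ j\<bar>)))"

definition lattice_ball :: "nat \<Rightarrow> (int ^ 'n) set" where
  "lattice_ball K = {k. \<forall>j. \<bar>k $ j\<bar> \<le> int K}"

text \<open>The shape of a Taylor term of \<open>wave q\<close> about the lattice frequency
  \<open>k\<close>: the list names the coordinates of a monomial, and the phase shift by its length
  records the order of the derivative.\<close>

definition atom :: "nat \<Rightarrow> int ^ 'n \<Rightarrow> 'n list \<Rightarrow> real ^ 'n \<Rightarrow> real" where
  "atom q k l x = wave (q + length l) (2 * pi * (\<Sum>j\<in>UNIV. x $ j * of_int (k $ j)))
     * prod_list (map (($) x) l)"

text \<open>The base \<open>2 * d\<close> is large enough that the \<open>d ^ m\<close> words of
  length \<open>m\<close> add only a geometric factor to the count of atoms by weight, while the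
  factorial in the Taylor coefficients still keeps the weighted coefficient sum bounded.\<close>

definition atom_weight :: "int ^ 'n \<Rightarrow> 'n list \<Rightarrow> real" where
  "atom_weight k l = (1 + lattice_norm k) * (2 * real CARD('n)) ^ length l"

text \<open>The summand at \<open>k = 0\<close>, \<open>l = []\<close> represents the \<open>- 1\<close> of \<open>exp (2\<pi>i x \<bullet> \<xi>) - 1\<close>. In the cell of
  the origin it cancels the constant Taylor term, so that the coefficients are \<open>O(norm \<xi>)\<close>. This matters
  since the mass of the measure near \<open>0\<close> is not bounded in terms of \<open>C\<close>.\<close>

definition atom_coeff :: "int ^ 'n \<Rightarrow> 'n list \<Rightarrow> real ^ 'n \<Rightarrow> real" where
  "atom_coeff k l \<xi> =
     (if k = lattice_point \<xi>
      then (2 * pi) ^ length l / fact (length l) * prod_list (map (lattice_offset \<xi>) l) else 0)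
     - (if k = 0 \<and> l = [] then 1 else 0)"

lemma abs_le_lattice_norm: "of_int \<bar>k $ j\<bar> \<le> lattice_norm k"
  for k :: "int ^ 'n::finite"
  unfolding lattice_norm_def of_int_le_iff by (rule Max_ge) auto

lemma lattice_norm_le_iff: "lattice_norm k \<le> t \<longleftrightarrow> (\<forall>j. of_int \<bar>k $ j\<bar> \<le> t)"
  for k :: "int ^ 'n::finite"
proof
  assume R: "\<forall>j. of_int \<bar>k $ j\<bar> \<le> t"
  have "Max (range (\<lambda>j. \<bar>k $ j\<bar>)) \<in> range (\<lambda>j. \<bar>k $ j\<bar>)" by (rule Max_in) auto
  then obtain j where "Max (range (\<lambda>j. \<bar>k $ j\<bar>)) = \<bar>k $ j\<bar>" by blast
  then show "lattice_norm k \<le> t" using R unfolding lattice_norm_def by simp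
qed (use abs_le_lattice_norm order_trans in blast)

lemma lattice_norm_nonneg: "0 \<le> lattice_norm k" for k :: "int ^ 'n::finite"
  using abs_le_lattice_norm[of k undefined] by (meson abs_ge_zero of_int_0_le_iff order_trans)

lemma lattice_norm_0: "lattice_norm (0 :: int ^ 'n::finite) = 0"
  by (simp add: lattice_norm_def)

lemma real_card_ge_1: "1 \<le> real CARD('a::finite)"
  using zero_less_card_finite[where 'a = 'a] by linarith

lemma atom_weight_ge_1: "1 \<le> atom_weight k l" for k :: "int ^ 'n::finite"
proof -
  have d: "1 \<le> 2 * real CARD('n)" using real_card_ge_1[where 'a = 'n] by linarith
  show ?thesis unfolding atom_weight_def
    using mult_mono[of 1 "1 + lattice_norm k" 1 "(2 * real CARD('n)) ^ length l"]
      lattice_norm_nonneg[of k] one_le_power[OF d, of "length l"] by simp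
qed

lemma
  shows finite_lattice_ball: "finite (lattice_ball K :: (int ^ 'n::finite) set)"
    and card_lattice_ball: "card (lattice_ball K :: (int ^ 'n) set) \<le> (2 * K + 1) ^ CARD('n)"
proof -
  let ?P = "PiE UNIV (\<lambda>_ :: 'n. {- int K..int K})"
  have sub: "(lattice_ball K :: (int ^ 'n) set) \<subseteq> vec_lambda ` ?P"
  proof
    fix k :: "int ^ 'n" assume "k \<in> lattice_ball K"
    then have "($) k \<in> ?P" by (auto simp: lattice_ball_def abs_le_iff) (metis minus_le_iff)
    moreover have "k = vec_lambda (($) k)" by simp
    ultimately show "k \<in> vec_lambda ` ?P" by blast
  qed
  have fin: "finite ?P" by (intro finite_PiE) auto
  show "finite (lattice_ball K :: (int ^ 'n) set)"
    using sub fin by (meson finite_imageI finite_subset)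
  have "card (lattice_ball K :: (int ^ 'n) set) \<le> card ?P"
    using sub fin by (meson card_image_le card_mono finite_imageI order_trans)
  also have "card ?P = (2 * K + 1) ^ CARD('n)"
    by (subst card_PiE) (auto simp: nat_add_distrib nat_mult_distrib)
  finally show "card (lattice_ball K :: (int ^ 'n) set) \<le> (2 * K + 1) ^ CARD('n)" .
qed

lemma abs_lattice_offset_le: "\<bar>lattice_offset \<xi> j\<bar> \<le> 1 / 2"
  unfolding lattice_offset_def lattice_point_def
  using of_int_round_abs_le[of "\<xi> $ j"] by (simp add: abs_minus_commute)

lemma sum_abs_lattice_offset_le: "(\<Sum>j\<in>UNIV. \<bar>lattice_offset \<xi> j\<bar>) \<le> real CARD('n) / 2"
  for \<xi> :: "real ^ 'n::finite"
  using sum_bounded_above[of UNIV "\<lambda>j. \<bar>lattice_offset \<xi> j\<bar>" "1/2"] abs_lattice_offset_le by auto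

text \<open>Outside the cell of the origin this allows constants to be absorbed into
  \<open>norm \<xi>\<close>, the quantity whose integral is controlled.\<close>

lemma norm_ge_half_of_lattice_point_neq_0:
  assumes "lattice_point \<xi> \<noteq> 0"
  shows "1 / 2 \<le> norm (\<xi> :: real ^ 'n::finite)"
proof -
  obtain j where "round (\<xi> $ j) \<noteq> 0"
    using assms by (auto simp: lattice_point_def vec_eq_iff)
  moreover have "\<bar>\<xi> $ j\<bar> \<ge> 1 / 2" if "\<bar>of_int k - \<xi> $ j\<bar> \<le> 1 / 2" "k \<noteq> 0" for k :: int
  proof -
    have "1 \<le> \<bar>of_int k :: real\<bar>" using that(2) by linarith
    then show ?thesis using that(1) by linarith
  qed
  ultimately have "1 / 2 \<le> \<bar>\<xi> $ j\<bar>" using of_int_round_abs_le[of "\<xi> $ j"] by blast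
  then show ?thesis using component_le_norm_cart[of \<xi> j] by simp
qed

lemma sum_abs_lattice_offset_le_norm:
  "(\<Sum>j\<in>UNIV. \<bar>lattice_offset \<xi> j\<bar>) \<le> real CARD('n) * norm \<xi>" for \<xi> :: "real ^ 'n::finite"
proof -
  have "\<bar>lattice_offset \<xi> j\<bar> \<le> norm \<xi>" for j
  proof (cases "lattice_point \<xi> = 0")
    case True
    then show ?thesis using component_le_norm_cart[of \<xi> j] by (simp add: lattice_offset_def)
  next
    case False
    then show ?thesis
      using norm_ge_half_of_lattice_point_neq_0[OF False] abs_lattice_offset_le[of \<xi> j] by simp
  qed
  then show ?thesis
    using sum_bounded_above[of UNIV "\<lambda>j. \<bar>lattice_offset \<xi> j\<bar>" "norm \<xi>"] by simp
qed

lemma lattice_norm_lattice_point_le: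
  assumes "lattice_point \<xi> \<noteq> 0"
  shows "1 + lattice_norm (lattice_point \<xi>) \<le> 4 * norm (\<xi> :: real ^ 'n::finite)"
proof -
  note half = norm_ge_half_of_lattice_point_neq_0[OF assms]
  have "of_int \<bar>lattice_point \<xi> $ j\<bar> \<le> 2 * norm \<xi>" for j
  proof -
    have "\<bar>real_of_int (round (\<xi> $ j))\<bar> \<le> \<bar>of_int (round (\<xi> $ j)) - \<xi> $ j\<bar> + \<bar>\<xi> $ j\<bar>" by arith
    then show ?thesis
      using of_int_round_abs_le[of "\<xi> $ j"] component_le_norm_cart[of \<xi> j] half
      by (simp add: lattice_point_def)
  qed
  then have "lattice_norm (lattice_point \<xi>) \<le> 2 * norm \<xi>" by (simp add: lattice_norm_le_iff)
  then show ?thesis using half by simp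
qed

text \<open>A frequency sees one lattice point and the correction at the origin. The test function
  \<open>G\<close> is arbitrary so that the evaluation serves twice: with atoms for the
  approximation error, with signed weights for the weighted norm.\<close>

lemma sum_atom_coeff:
  fixes G :: "int ^ 'n::finite \<Rightarrow> 'n list \<Rightarrow> real"
  assumes "0 < M"
  shows "(\<Sum>k\<in>lattice_ball K. \<Sum>l | length l < M. atom_coeff k l \<xi> * G k l)
     = (if lattice_point \<xi> \<in> lattice_ball K
        then \<Sum>l | length l < M. (2 * pi) ^ length l / fact (length l)
               * prod_list (map (lattice_offset \<xi>) l) * G (lattice_point \<xi>) l
        else 0) - G 0 []"
proof -
  let ?t = "\<lambda>l. (2 * pi) ^ length l / fact (length l) * prod_list (map (lattice_offset \<xi>) l)"
  have 0: "(0 :: int ^ 'n) \<in> lattice_ball K" by (simp add: lattice_ball_def)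
  have "(\<Sum>k\<in>lattice_ball K. \<Sum>l | length l < M. atom_coeff k l \<xi> * G k l)
     = (\<Sum>k\<in>lattice_ball K. (if k = lattice_point \<xi> then \<Sum>l | length l < M. ?t l * G k l else 0)
          - (if k = 0 then G 0 [] else 0))"
  proof (rule sum.cong[OF refl])
    fix k
    have "(\<Sum>l | length l < M. atom_coeff k l \<xi> * G k l)
      = (\<Sum>l | length l < M. (if k = lattice_point \<xi> then ?t l * G k l else 0)
           - (if l = [] then (if k = 0 then G 0 [] else 0) else 0))"
      by (rule sum.cong) (auto simp: atom_coeff_def algebra_simps)
    also have "\<dots> = (\<Sum>l | length l < M. (if k = lattice_point \<xi> then ?t l * G k l else 0))
           - (if k = 0 then G 0 [] else 0)"
      unfolding sum_subtractf using assms by (subst sum.delta) (auto simp: finite_lists_length_less)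
    finally show "(\<Sum>l | length l < M. atom_coeff k l \<xi> * G k l)
       = (if k = lattice_point \<xi> then \<Sum>l | length l < M. ?t l * G k l else 0)
           - (if k = 0 then G 0 [] else 0)" by simp
  qed
  also have "\<dots> = (if lattice_point \<xi> \<in> lattice_ball K
        then \<Sum>l | length l < M. ?t l * G (lattice_point \<xi>) l else 0) - G 0 []"
    unfolding sum_subtractf using 0 by (simp add: sum.delta finite_lattice_ball)
  finally show ?thesis .
qed

text \<open>By the word expansion, words of length \<open>m\<close> contribute exactly
  \<open>y ^ m / fact m\<close>, so the exponential series bounds the sum for every \<open>M\<close>
  at once.\<close>

lemma sum_power_offset_le:
  fixes \<xi> :: "real ^ 'n::finite"
  defines "y \<equiv> 4 * pi * real CARD('n) * (\<Sum>j\<in>UNIV. \<bar>lattice_offset \<xi> j\<bar>)"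
  shows "(\<Sum>l | length l < M. (2 * real CARD('n)) ^ length l *
           \<bar>(2 * pi) ^ length l / fact (length l) * prod_list (map (lattice_offset \<xi>) l)\<bar>) \<le> exp y"
proof -
  let ?d = "real CARD('n)"
  have "(\<Sum>l | length l < M. (2 * ?d) ^ length l *
           \<bar>(2 * pi) ^ length l / fact (length l) * prod_list (map (lattice_offset \<xi>) l)\<bar>)
      = (\<Sum>m<M. \<Sum>l | length l = m. ((4 * pi * ?d) ^ m / fact m) *
           prod_list (map (\<lambda>j. \<bar>lattice_offset \<xi> j\<bar>) l))"
    unfolding sum_lists_length_less
  proof (intro sum.cong refl)
    fix m and l :: "'n list" assume "l \<in> {l. length l = m}"
    then have m: "length l = m" by simp
    have "(2 * ?d) ^ m * (2 * pi) ^ m = (4 * pi * ?d) ^ m"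
      unfolding power_mult_distrib[symmetric] by (simp add: mult_ac)
    moreover have "\<bar>prod_list (map (lattice_offset \<xi>) l)\<bar>
        = prod_list (map (\<lambda>j. \<bar>lattice_offset \<xi> j\<bar>) l)"
      unfolding abs_prod_list by (simp add: o_def)
    ultimately show "(2 * ?d) ^ length l *
           \<bar>(2 * pi) ^ length l / fact (length l) * prod_list (map (lattice_offset \<xi>) l)\<bar>
        = ((4 * pi * ?d) ^ m / fact m) * prod_list (map (\<lambda>j. \<bar>lattice_offset \<xi> j\<bar>) l)"
      unfolding m abs_mult abs_divide by simp
  qed
  also have "\<dots> = (\<Sum>m<M. y ^ m / fact m)"
    unfolding sum_distrib_left[symmetric] sum_lists_prod_list y_def power_mult_distrib by simp
  also have "\<dots> \<le> exp y"
    by (rule sum_exp_series_le) (simp add: y_def sum_nonneg)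
  finally show ?thesis .
qed

text \<open>The bound has to vanish linearly at the origin. In the cell of the origin the sum is at
  most \<open>exp y - 1 \<le> y * exp y\<close> with \<open>y\<close> of order
  \<open>norm \<xi>\<close>; in the other cells both the weight of the lattice point and the
  correction \<open>1\<close> are of order \<open>norm \<xi>\<close>.\<close>

lemma sum_weight_atom_coeff_le:
  fixes \<xi> :: "real ^ 'n::finite"
  defines "d \<equiv> real CARD('n)"
  assumes "0 < M"
  shows "(\<Sum>k\<in>lattice_ball K. \<Sum>l | length l < M. atom_weight k l * \<bar>atom_coeff k l \<xi>\<bar>)
    \<le> 4 * pi * d\<^sup>2 * exp (2 * pi * d\<^sup>2) * norm \<xi>"
proof -
  let ?t = "\<lambda>l. (2 * pi) ^ length l / fact (length l) * prod_list (map (lattice_offset \<xi>) l)"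
  let ?E = "exp (2 * pi * d\<^sup>2)"
  define y where "y = 4 * pi * d * (\<Sum>j\<in>UNIV. \<bar>lattice_offset \<xi> j\<bar>)"
  have d1: "1 \<le> d" unfolding d_def by (rule real_card_ge_1)
  have y0: "0 \<le> y" using d1 by (simp add: y_def sum_nonneg)
  have "y \<le> 4 * pi * d * (d / 2)"
    unfolding y_def using d1 sum_abs_lattice_offset_le[of \<xi>]
    by (intro mult_left_mono) (auto simp: d_def)
  then have y1: "y \<le> 2 * pi * d\<^sup>2" by (simp add: power2_eq_square)
  have "y \<le> 4 * pi * d * (d * norm \<xi>)"
    unfolding y_def using d1 sum_abs_lattice_offset_le_norm[of \<xi>]
    by (intro mult_left_mono) (auto simp: d_def)
  then have y2: "y \<le> 4 * pi * d\<^sup>2 * norm \<xi>" by (simp add: power2_eq_square)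
  have E: "exp y \<le> ?E" using y1 by simp
  \<comment> \<open>The sign turns the absolute values into the linear form evaluated by
    \<open>sum_atom_coeff\<close>.\<close>
  define G where "G k l = atom_weight k l * sgn (atom_coeff k l \<xi>)" for k l
  have sum_eq: "(\<Sum>k\<in>lattice_ball K. \<Sum>l | length l < M. atom_weight k l * \<bar>atom_coeff k l \<xi>\<bar>)
     = (\<Sum>k\<in>lattice_ball K. \<Sum>l | length l < M. atom_coeff k l \<xi> * G k l)"
    by (intro sum.cong refl) (simp add: G_def abs_sgn mult_ac)
  have G_le: "x * G k l \<le> \<bar>x\<bar> * atom_weight k l" for x k l
  proof -
    have "\<bar>G k l\<bar> \<le> atom_weight k l"
      using atom_weight_ge_1[of k l] by (simp add: G_def abs_mult sgn_real_def)
    then have "\<bar>x\<bar> * \<bar>G k l\<bar> \<le> \<bar>x\<bar> * atom_weight k l" by (rule mult_left_mono) simp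
    then show ?thesis using abs_ge_self[of "x * G k l"] by (simp add: abs_mult)
  qed
  have pow: "(\<Sum>l | length l < M. (2 * d) ^ length l * \<bar>?t l\<bar>) \<le> exp y"
    using sum_power_offset_le[where M = M and \<xi> = \<xi>] by (simp add: y_def d_def)
  show ?thesis
  proof (cases "lattice_point \<xi> = 0")
    case True
    have "(\<Sum>k\<in>lattice_ball K. \<Sum>l | length l < M. atom_coeff k l \<xi> * G k l)
        = (\<Sum>l | length l < M. ?t l * G 0 l) - G 0 []"
      unfolding sum_atom_coeff[OF assms(2)] using True by (simp add: lattice_ball_def)
    \<comment> \<open>The constant Taylor coefficient \<open>1\<close> meets the correction
      \<open>1\<close>: the coefficient is \<open>0\<close>, and so is its sign. This removes the
      empty word from the sum.\<close>
    also have "G 0 [] = 0" using True by (simp add: G_def atom_coeff_def)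
    also have "(\<Sum>l | length l < M. ?t l * G 0 l)
       = (\<Sum>l\<in>{l. length l < M} - {[]}. ?t l * G 0 l)"
      using \<open>G 0 [] = 0\<close> by (intro sum.mono_neutral_right) (auto simp: finite_lists_length_less)
    also have "\<dots> \<le> (\<Sum>l\<in>{l. length l < M} - {[]}. (2 * d) ^ length l * \<bar>?t l\<bar>)"
    proof (rule sum_mono)
      fix l show "?t l * G 0 l \<le> (2 * d) ^ length l * \<bar>?t l\<bar>"
        using G_le[of "?t l" 0 l] by (simp add: atom_weight_def lattice_norm_0 d_def mult_ac)
    qed
    also have "\<dots> = (\<Sum>l | length l < M. (2 * d) ^ length l * \<bar>?t l\<bar>) - 1"
      using assms(2) by (subst sum_diff1) (auto simp: finite_lists_length_less)
    also have "\<dots> \<le> exp y - 1" using pow by simp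
    also have "\<dots> \<le> y * exp y"
    proof -
      have "1 + - y \<le> exp (- y)" by (rule exp_ge_add_one_self)
      then have "(1 - y) * exp y \<le> exp (- y) * exp y" by (intro mult_right_mono) auto
      then show ?thesis by (simp add: exp_minus algebra_simps)
    qed
    also have "\<dots> \<le> (4 * pi * d\<^sup>2 * norm \<xi>) * ?E"
      using y2 E y0 by (intro mult_mono) auto
    finally show ?thesis unfolding sum_eq by (simp add: mult_ac)
  next
    case False
    note half = norm_ge_half_of_lattice_point_neq_0[OF False]
    let ?p = "lattice_point \<xi>"
    have "(\<Sum>k\<in>lattice_ball K. \<Sum>l | length l < M. atom_coeff k l \<xi> * G k l)
        \<le> (\<Sum>l | length l < M. \<bar>?t l\<bar> * atom_weight ?p l) + 1"
    proof -
      have "- G 0 [] \<le> 1"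
        using G_le[of "-1" 0 "[]"] by (simp add: atom_weight_def lattice_norm_0)
      moreover have "(\<Sum>l | length l < M. ?t l * G ?p l) \<le> (\<Sum>l | length l < M. \<bar>?t l\<bar> * atom_weight ?p l)"
        by (intro sum_mono G_le)
      moreover have "0 \<le> (\<Sum>l | length l < M. \<bar>?t l\<bar> * atom_weight ?p l)"
        using atom_weight_ge_1 by (intro sum_nonneg mult_nonneg_nonneg) (auto intro: order_trans[OF zero_le_one])
      ultimately show ?thesis unfolding sum_atom_coeff[OF assms(2)] by simp
    qed
    also have "(\<Sum>l | length l < M. \<bar>?t l\<bar> * atom_weight ?p l)
        = (1 + lattice_norm ?p) * (\<Sum>l | length l < M. (2 * d) ^ length l * \<bar>?t l\<bar>)"
      by (simp add: atom_weight_def d_def sum_distrib_left mult_ac)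
    also have "\<dots> \<le> (4 * norm \<xi>) * ?E"
      by (rule mult_mono[OF lattice_norm_lattice_point_le[OF False] order_trans[OF pow E]])
        (use d1 in \<open>auto intro!: sum_nonneg\<close>)
    also have "(4 * norm \<xi>) * ?E + 1 \<le> 6 * (?E * norm \<xi>)"
    proof -
      have "1 \<le> 2 * norm \<xi> * 1" using half by simp
      also have "\<dots> \<le> 2 * norm \<xi> * ?E" by (intro mult_left_mono) auto
      finally show ?thesis by simp
    qed
    also have "\<dots> \<le> (4 * pi * d\<^sup>2) * (?E * norm \<xi>)"
    proof (intro mult_right_mono)
      have "1 \<le> d\<^sup>2" using d1 by simp
      then have "4 * 3 * 1 \<le> 4 * pi * d\<^sup>2" using pi_gt3 by (intro mult_mono) auto
      then show "6 \<le> 4 * pi * d\<^sup>2" by simp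
    qed auto
    finally show ?thesis unfolding sum_eq by (simp add: mult_ac)
  qed
qed

text \<open>Inside the ball the error is the Taylor remainder. Outside it the truncated sum reduces
  to \<open>- wave q 0\<close>, so the error is the wave itself, at most \<open>1\<close>, and
  \<open>norm \<xi> \<ge> K\<close> turns this into \<open>norm \<xi> / K\<close>.\<close>

lemma atom_expansion_error:
  fixes \<xi> x :: "real ^ 'n::finite"
  defines "d \<equiv> real CARD('n)"
  assumes x: "x \<in> cbox 0 1" and M: "0 < M" and K: "0 < K"
  shows "\<bar>wave q (2 * pi * (x \<bullet> \<xi>)) - wave q 0
      - (\<Sum>k\<in>lattice_ball K. \<Sum>l | length l < M. atom_coeff k l \<xi> * atom q k l x)\<bar>
    \<le> max (1 / K) (2 * (pi * d) ^ M / fact M) * norm \<xi>"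
proof -
  let ?p = "lattice_point \<xi>"
  define a where "a = 2 * pi * (\<Sum>j\<in>UNIV. x $ j * of_int (?p $ j))"
  define s where "s = (\<Sum>j\<in>UNIV. x $ j * lattice_offset \<xi> j)"
  have x01: "0 \<le> x $ j" "x $ j \<le> 1" for j using x by (auto simp: mem_box_cart)
  have ab: "2 * pi * (x \<bullet> \<xi>) = a + 2 * pi * s"
    by (simp add: inner_vec_def a_def s_def lattice_offset_def sum_subtractf algebra_simps
        sum_distrib_left sum.distrib[symmetric])
  have atom00: "atom q 0 [] x = wave q 0" by (simp add: atom_def)
  show ?thesis
  proof (cases "?p \<in> lattice_ball K")
    case True
    have "(\<Sum>l | length l < M. (2 * pi) ^ length l / fact (length l)
               * prod_list (map (lattice_offset \<xi>) l) * atom q ?p l x)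
        = (\<Sum>m<M. \<Sum>l | length l = m. wave (q + m) a * ((2 * pi) ^ m / fact m)
               * prod_list (map (\<lambda>j. x $ j * lattice_offset \<xi> j) l))"
    proof -
      have pl: "prod_list (map (\<lambda>j. x $ j * lattice_offset \<xi> j) l)
          = prod_list (map (lattice_offset \<xi>) l) * prod_list (map (($) x) l)" for l
        by (induction l) (auto simp: mult_ac)
      show ?thesis unfolding sum_lists_length_less pl
        by (intro sum.cong refl) (auto simp: atom_def a_def)
    qed
    also have "\<dots> = (\<Sum>m<M. wave (q + m) a * (2 * pi * s) ^ m / fact m)"
      unfolding sum_distrib_left[symmetric] sum_lists_prod_list s_def[symmetric] power_mult_distrib
      by (simp add: mult_ac)
    finally have "\<bar>wave q (2 * pi * (x \<bullet> \<xi>)) - wave q 0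
      - (\<Sum>k\<in>lattice_ball K. \<Sum>l | length l < M. atom_coeff k l \<xi> * atom q k l x)\<bar>
      = \<bar>wave q (a + 2 * pi * s) - (\<Sum>m<M. wave (q + m) a * (2 * pi * s) ^ m / fact m)\<bar>"
      unfolding sum_atom_coeff[OF M] atom00 ab using True by simp
    also have "\<dots> \<le> \<bar>2 * pi * s\<bar> ^ M / fact M" by (rule wave_Taylor)
    \<comment> \<open>One factor of the remainder is spent on \<open>norm \<xi>\<close>, so that the
      error can be integrated; the other \<open>M - 1\<close> factors use the uniform bound on the
      offsets.\<close>
    also have "\<bar>2 * pi * s\<bar> ^ M \<le> (2 * pi * d * norm \<xi>) * (pi * d) ^ (M - 1)"
    proof -
      have "\<bar>s\<bar> \<le> (\<Sum>j\<in>UNIV. \<bar>lattice_offset \<xi> j\<bar>)"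
        unfolding s_def
        by (rule order_trans[OF sum_abs])
          (auto intro!: sum_mono mult_left_le_one_le simp: abs_mult x01)
      then have "\<bar>s\<bar> \<le> d / 2" "\<bar>s\<bar> \<le> d * norm \<xi>"
        using sum_abs_lattice_offset_le[of \<xi>] sum_abs_lattice_offset_le_norm[of \<xi>]
        by (auto simp: d_def)
      then have 1: "\<bar>2 * pi * s\<bar> \<le> 2 * pi * d * norm \<xi>" and 2: "\<bar>2 * pi * s\<bar> \<le> pi * d"
        by (auto simp: abs_mult)
      have "\<bar>2 * pi * s\<bar> ^ M = \<bar>2 * pi * s\<bar> * \<bar>2 * pi * s\<bar> ^ (M - 1)"
        using M by (metis power_eq_if less_numeral_extra(3))
      also have "\<dots> \<le> (2 * pi * d * norm \<xi>) * (pi * d) ^ (M - 1)"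
        using 1 2 by (intro mult_mono power_mono) (auto simp: d_def)
      finally show ?thesis .
    qed
    also have "(2 * pi * d * norm \<xi>) * (pi * d) ^ (M - 1) = 2 * (pi * d) ^ M * norm \<xi>"
      using M power_eq_if[of "pi * d" M] by simp
    also have "2 * (pi * d) ^ M * norm \<xi> / fact M = (2 * (pi * d) ^ M / fact M) * norm \<xi>" by simp
    also have "\<dots> \<le> max (1 / K) (2 * (pi * d) ^ M / fact M) * norm \<xi>"
      by (intro mult_right_mono) auto
    finally show ?thesis by (simp add: divide_right_mono)
  next
    case False
    then obtain j where j: "int K < \<bar>round (\<xi> $ j)\<bar>"
      by (auto simp: lattice_ball_def lattice_point_def not_le)
    then have "real_of_int (int K + 1) \<le> real_of_int \<bar>round (\<xi> $ j)\<bar>" by (simp only: of_int_le_iff)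
    moreover have "\<bar>real_of_int (round (\<xi> $ j))\<bar> \<le> \<bar>of_int (round (\<xi> $ j)) - \<xi> $ j\<bar> + \<bar>\<xi> $ j\<bar>" by arith
    ultimately have "real K \<le> \<bar>\<xi> $ j\<bar>" using of_int_round_abs_le[of "\<xi> $ j"] by simp
    then have "real K \<le> norm \<xi>" using component_le_norm_cart[of \<xi> j] by simp
    then have "1 \<le> 1 / K * norm \<xi>" using K by (simp add: field_simps)
    also have "\<dots> \<le> max (1 / K) (2 * (pi * d) ^ M / fact M) * norm \<xi>"
      by (intro mult_right_mono) auto
    finally have "1 \<le> max (1 / K) (2 * (pi * d) ^ M / fact M) * norm \<xi>" .
    moreover have "\<bar>wave q (2 * pi * (x \<bullet> \<xi>)) - wave q 0
      - (\<Sum>k\<in>lattice_ball K. \<Sum>l | length l < M. atom_coeff k l \<xi> * atom q k l x)\<bar> \<le> 1"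
      unfolding sum_atom_coeff[OF M] atom00 using False abs_wave_le_1 by simp
    ultimately show ?thesis by linarith
  qed
qed

section \<open>Size and Lipschitz constants of atoms\<close>

lemma abs_prod_list_le_1:
  fixes x :: "'n \<Rightarrow> real"
  assumes "\<And>j. \<bar>x j\<bar> \<le> 1"
  shows "\<bar>prod_list (map x l)\<bar> \<le> 1"
proof (induction l)
  case (Cons j l)
  then show ?case using assms[of j] by (simp add: abs_mult mult_le_one)
qed simp

lemma abs_prod_list_diff_le:
  fixes x y :: "'n \<Rightarrow> real"
  assumes "\<And>j. \<bar>x j\<bar> \<le> 1" "\<And>j. \<bar>y j\<bar> \<le> 1" "\<And>j. \<bar>x j - y j\<bar> \<le> D"
  shows "\<bar>prod_list (map x l) - prod_list (map y l)\<bar> \<le> real (length l) * D"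
proof (induction l)
  case (Cons j l)
  let ?X = "prod_list (map x l)" and ?Y = "prod_list (map y l)"
  have "x j * ?X - y j * ?Y = (x j - y j) * ?X + y j * (?X - ?Y)" by (simp add: algebra_simps)
  then have "\<bar>x j * ?X - y j * ?Y\<bar> \<le> \<bar>x j - y j\<bar> * \<bar>?X\<bar> + \<bar>y j\<bar> * \<bar>?X - ?Y\<bar>"
    by (simp add: abs_mult[symmetric] abs_triangle_ineq)
  also have "\<dots> \<le> D * 1 + 1 * (real (length l) * D)"
    using assms(3)[of j] assms(2)[of j] abs_prod_list_le_1[OF assms(1)] Cons
    by (intro add_mono mult_mono) auto
  finally show ?case by (simp add: algebra_simps)
qed simp

lemma abs_component_cbox_le_1: "x \<in> cbox 0 1 \<Longrightarrow> \<bar>x $ j\<bar> \<le> 1" for x :: "real ^ 'n"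
  by (auto simp: mem_box_cart abs_le_iff intro: order_trans[of "- _" 0])

lemma abs_atom_le_1:
  assumes "x \<in> cbox 0 1"
  shows "\<bar>atom q k l x\<bar> \<le> 1"
  unfolding atom_def abs_mult
  using abs_component_cbox_le_1[OF assms] by (intro mult_le_one abs_wave_le_1 abs_prod_list_le_1) auto

text \<open>The wave has Lipschitz constant \<open>2 * pi * lattice_norm k\<close> and the monomial
  has \<open>length l\<close>, which the power of \<open>2 * d\<close> exceeds. A bound on the
  weighted norm of coefficients is thus a Lipschitz bound on the combination.\<close>

lemma atom_Lipschitz:
  fixes x y :: "real ^ 'n::finite"
  assumes x: "x \<in> cbox 0 1" and y: "y \<in> cbox 0 1"
  shows "\<bar>atom q k l x - atom q k l y\<bar> \<le> 2 * pi * atom_weight k l * (\<Sum>j\<in>UNIV. \<bar>x $ j - y $ j\<bar>)"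
proof -
  let ?D = "\<Sum>j\<in>UNIV. \<bar>x $ j - y $ j\<bar>" and ?K = "lattice_norm k" and ?m = "length l"
  define u where "u z = wave (q + ?m) (2 * pi * (\<Sum>j\<in>UNIV. z $ j * of_int (k $ j)))"
    for z :: "real ^ 'n"
  define v where "v z = prod_list (map (($) z) l)" for z :: "real ^ 'n"
  have D0: "0 \<le> ?D" by (simp add: sum_nonneg)
  have u: "\<bar>u x - u y\<bar> \<le> 2 * pi * (?K * ?D)"
  proof -
    have "\<bar>u x - u y\<bar> \<le> \<bar>2 * pi * (\<Sum>j\<in>UNIV. x $ j * of_int (k $ j))
        - 2 * pi * (\<Sum>j\<in>UNIV. y $ j * of_int (k $ j))\<bar>"
      unfolding u_def by (rule wave_Lipschitz)
    also have "\<dots> = 2 * pi * \<bar>\<Sum>j\<in>UNIV. (x $ j - y $ j) * of_int (k $ j)\<bar>"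
      by (simp add: right_diff_distrib[symmetric] sum_subtractf[symmetric] left_diff_distrib[symmetric] abs_mult)
    also have "\<bar>\<Sum>j\<in>UNIV. (x $ j - y $ j) * of_int (k $ j)\<bar> \<le> (\<Sum>j\<in>UNIV. ?K * \<bar>x $ j - y $ j\<bar>)"
      by (rule order_trans[OF sum_abs])
        (use abs_le_lattice_norm[of k] in
          \<open>auto intro!: sum_mono mult_right_mono simp: abs_mult mult.commute[of _ "\<bar>of_int _\<bar>"]\<close>)
    finally show ?thesis by (simp add: sum_distrib_left)
  qed
  have v: "\<bar>v x - v y\<bar> \<le> real ?m * ?D"
    unfolding v_def
    by (rule abs_prod_list_diff_le)
      (use x y abs_component_cbox_le_1 in \<open>auto intro!: member_le_sum\<close>)
  have v1: "\<bar>v x\<bar> \<le> 1"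
    unfolding v_def using abs_component_cbox_le_1[OF x] by (rule abs_prod_list_le_1)
  have u1: "\<bar>u y\<bar> \<le> 1" unfolding u_def by (rule abs_wave_le_1)
  have "atom q k l x - atom q k l y = (u x - u y) * v x + u y * (v x - v y)"
    by (simp add: atom_def u_def v_def algebra_simps)
  then have "\<bar>atom q k l x - atom q k l y\<bar> \<le> \<bar>u x - u y\<bar> * \<bar>v x\<bar> + \<bar>u y\<bar> * \<bar>v x - v y\<bar>"
    by (simp add: abs_mult[symmetric] abs_triangle_ineq)
  also have "\<dots> \<le> (2 * pi * (?K * ?D)) * 1 + 1 * (real ?m * ?D)"
    using u v v1 u1 D0 lattice_norm_nonneg[of k] by (intro add_mono mult_mono) auto
  also have "\<dots> = (2 * pi * ?K + real ?m) * ?D" by (simp add: algebra_simps)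
  also have "\<dots> \<le> (2 * pi * atom_weight k l) * ?D"
  proof (rule mult_right_mono[OF _ D0])
    have "real ?m + 1 \<le> 2 ^ ?m"
      using of_nat_mono[OF Suc_leI[OF less_exp[of ?m]], where 'a = real] by simp
    also have "\<dots> \<le> (2 * real CARD('n)) ^ ?m"
      using real_card_ge_1[where 'a = 'n] by (intro power_mono) linarith+
    finally have m: "real ?m + 1 \<le> (2 * real CARD('n)) ^ ?m" .
    have "?K + real ?m \<le> (1 + ?K) * (real ?m + 1)"
      using lattice_norm_nonneg[of k] by (simp add: algebra_simps)
    also have "\<dots> \<le> atom_weight k l"
      unfolding atom_weight_def using m lattice_norm_nonneg[of k] by (intro mult_left_mono) auto
    finally have "2 * pi * (?K + real ?m) \<le> 2 * pi * atom_weight k l" by (intro mult_left_mono) auto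
    moreover have "1 * real ?m \<le> 2 * pi * real ?m"
      using pi_gt3 by (intro mult_right_mono) auto
    ultimately show "2 * pi * ?K + real ?m \<le> 2 * pi * atom_weight k l" by (simp add: distrib_left)
  qed
  finally show ?thesis .
qed

section \<open>Counting atoms by weight\<close>

definition atom_indices :: "nat \<Rightarrow> nat \<Rightarrow> (nat \<times> (int ^ 'n) \<times> 'n list) set" where
  "atom_indices K M = {..<2} \<times> lattice_ball K \<times> {l. length l < M}"

lemma finite_atom_indices: "finite (atom_indices K M :: (nat \<times> (int ^ 'n::finite) \<times> 'n list) set)"
  by (simp add: atom_indices_def finite_lattice_ball finite_lists_length_less)

lemma sum_atom_indices:
  "(\<Sum>(q, k, l)\<in>(atom_indices K M :: (nat \<times> (int ^ 'n::finite) \<times> 'n list) set). F q k l)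
    = (\<Sum>q<2. \<Sum>k\<in>lattice_ball K. \<Sum>l | length l < M. F q k l)"
  by (simp add: atom_indices_def sum.cartesian_product finite_lattice_ball finite_lists_length_less)

lemma lattice_norm_le_subset_lattice_ball:
  "{k :: int ^ 'n::finite. lattice_norm k \<le> t} \<subseteq> lattice_ball (nat \<lfloor>t\<rfloor>)"
proof (rule subsetI)
  fix k :: "int ^ 'n" assume "k \<in> {k. lattice_norm k \<le> t}"
  then have "of_int \<bar>k $ j\<bar> \<le> t" for j using abs_le_lattice_norm[of k j] by simp
  then have "\<bar>k $ j\<bar> \<le> \<lfloor>t\<rfloor>" for j by (simp only: le_floor_iff)
  then have "\<bar>k $ j\<bar> \<le> int (nat \<lfloor>t\<rfloor>)" for j by (rule order_trans) simp
  then show "k \<in> lattice_ball (nat \<lfloor>t\<rfloor>)" by (simp add: lattice_ball_def)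
qed

text \<open>The summand \<open>1\<close> makes a pure power of \<open>t\<close> possible: no point
  qualifies for \<open>t < 1\<close>, and otherwise each coordinate takes at most
  \<open>2 * (t - 1) + 1 \<le> 2 * t\<close> values.\<close>

lemma card_lattice_norm_le:
  assumes "0 < t"
  shows "real (card {k :: int ^ 'n::finite. 1 + lattice_norm k \<le> t}) \<le> (2 * t) ^ CARD('n)"
proof (cases "t < 1")
  case True
  have "t < 1 + lattice_norm k" for k :: "int ^ 'n"
    using lattice_norm_nonneg[of k] True by linarith
  then have "{k :: int ^ 'n. 1 + lattice_norm k \<le> t} = {}" by (simp add: not_le)
  then have "card {k :: int ^ 'n. 1 + lattice_norm k \<le> t} = 0" by (simp only: card.empty)
  then show ?thesis using assms by simp
next
  case False
  define N where "N = nat \<lfloor>t - 1\<rfloor>"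
  have "{k :: int ^ 'n. 1 + lattice_norm k \<le> t} \<subseteq> lattice_ball N"
    using lattice_norm_le_subset_lattice_ball[of "t - 1", where 'n = 'n]
    unfolding N_def by (simp only: le_diff_eq add.commute)
  then have "card {k :: int ^ 'n. 1 + lattice_norm k \<le> t} \<le> card (lattice_ball N :: (int ^ 'n) set)"
    by (rule card_mono[OF finite_lattice_ball])
  also have "\<dots> \<le> (2 * N + 1) ^ CARD('n)" by (rule card_lattice_ball)
  finally have "real (card {k :: int ^ 'n. 1 + lattice_norm k \<le> t}) \<le> real ((2 * N + 1) ^ CARD('n))"
    by (rule of_nat_mono)
  also have "\<dots> = (2 * real N + 1) ^ CARD('n)" by (simp add: add.commute)
  also have "\<dots> \<le> (2 * t) ^ CARD('n)"
  proof (rule power_mono)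
    have "real N \<le> t - 1" using False by (simp add: N_def)
    then show "2 * real N + 1 \<le> 2 * t" by simp
  qed simp
  finally show ?thesis .
qed

text \<open>There are \<open>d ^ m\<close> words of length \<open>m\<close>, but each letter shrinks
  the admissible lattice radius by \<open>2 * d\<close>; this leaves a geometric series of ratio at
  most \<open>1 / 2\<close>. The factor \<open>4\<close> is two phases times the sum of that series.
  Independence of \<open>K\<close> and \<open>M\<close> lets the truncation follow the
  accuracy.\<close>

lemma card_atom_weight_le:
  assumes r: "0 < r"
  shows "real (card {(q, k, l) \<in> (atom_indices K M :: (nat \<times> (int ^ 'n::finite) \<times> 'n list) set). atom_weight k l \<le> r})
    \<le> 4 * 2 ^ CARD('n) * r ^ CARD('n)"
proof -
  let ?d = "CARD('n)"
  define B where "B = 2 * real ?d"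
  have d1: "1 \<le> real ?d" by (rule real_card_ge_1)
  have B: "0 < B" using d1 by (simp add: B_def)
  have card_le: "real (card {k \<in> (lattice_ball K :: (int ^ 'n) set). 1 + lattice_norm k \<le> r / B ^ length l})
      \<le> (2 * (r / B ^ length l)) ^ ?d" for l :: "'n list"
  proof -
    let ?t = "r / B ^ length l"
    have t: "0 < ?t" using r B by simp
    have "{k :: int ^ 'n. lattice_norm k \<le> ?t - 1} \<subseteq> lattice_ball (nat \<lfloor>?t - 1\<rfloor>)"
      by (rule lattice_norm_le_subset_lattice_ball)
    then have "finite {k :: int ^ 'n. lattice_norm k \<le> ?t - 1}"
      by (rule finite_subset) (rule finite_lattice_ball)
    moreover have "{k :: int ^ 'n. 1 + lattice_norm k \<le> ?t} = {k. lattice_norm k \<le> ?t - 1}"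
      by (intro Collect_cong) linarith
    ultimately have "finite {k :: int ^ 'n. 1 + lattice_norm k \<le> ?t}" by (simp only:)
    then have "card {k \<in> (lattice_ball K :: (int ^ 'n) set). 1 + lattice_norm k \<le> ?t}
       \<le> card {k :: int ^ 'n. 1 + lattice_norm k \<le> ?t}"
      by (rule card_mono) auto
    then show ?thesis
      using card_lattice_norm_le[OF t, where 'n = 'n] by linarith
  qed
  have "{(q, k, l) \<in> (atom_indices K M :: (nat \<times> (int ^ 'n) \<times> 'n list) set). atom_weight k l \<le> r}
     = {..<2} \<times> (\<lambda>(l, k). (k, l)) `
       (SIGMA l:{l. length l < M}. {k \<in> lattice_ball K. 1 + lattice_norm k \<le> r / B ^ length l})"
  proof -
    have "atom_weight k l \<le> r \<longleftrightarrow> 1 + lattice_norm k \<le> r / B ^ length l" for k and l :: "'n list"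
    proof -
      have "atom_weight k l = (1 + lattice_norm k) * B ^ length l" by (simp only: atom_weight_def B_def)
      then show ?thesis using B by (simp add: pos_le_divide_eq)
    qed
    then show ?thesis by (auto simp: atom_indices_def image_iff)
  qed
  then have "card {(q, k, l) \<in> (atom_indices K M :: (nat \<times> (int ^ 'n) \<times> 'n list) set). atom_weight k l \<le> r}
     = 2 * card ((\<lambda>(l, k). (k, l)) `
       (SIGMA l:{l :: 'n list. length l < M}. {k \<in> (lattice_ball K :: (int ^ 'n) set). 1 + lattice_norm k \<le> r / B ^ length l}))"
    by (simp only: card_cartesian_product card_lessThan)
  also have "\<dots> = 2 * (\<Sum>l :: 'n list | length l < M.
       card {k \<in> (lattice_ball K :: (int ^ 'n) set). 1 + lattice_norm k \<le> r / B ^ length l})"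
    by (subst card_image) (auto simp: inj_on_def finite_lattice_ball finite_lists_length_less)
  finally have "real (card {(q, k, l) \<in> (atom_indices K M :: (nat \<times> (int ^ 'n) \<times> 'n list) set). atom_weight k l \<le> r})
    = 2 * (\<Sum>l :: 'n list | length l < M.
       real (card {k \<in> (lattice_ball K :: (int ^ 'n) set). 1 + lattice_norm k \<le> r / B ^ length l}))"
    by simp
  also have "\<dots> \<le> 2 * (\<Sum>l :: 'n list | length l < M. (2 * (r / B ^ length l)) ^ ?d)"
    by (intro mult_left_mono sum_mono card_le) simp
  also have "\<dots> = 2 * ((2 * r) ^ ?d * (\<Sum>m<M. (real ?d / B ^ ?d) ^ m))"
    by (simp add: sum_lists_length_less card_lists_length_UNIV power_divide power_mult_distrib
        sum_distrib_left power_mult[symmetric] mult_ac)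
  also have "(\<Sum>m<M. (real ?d / B ^ ?d) ^ m) \<le> (\<Sum>m<M. (1 / 2) ^ m)"
  proof (intro sum_mono power_mono)
    have "B ^ 1 \<le> B ^ ?d"
    proof (rule power_increasing)
      show "1 \<le> B" unfolding B_def using d1 by linarith
    qed (simp add: Suc_le_eq)
    then show "real ?d / B ^ ?d \<le> 1 / 2" using B by (simp add: B_def field_simps)
  qed (use B in auto)
  also have "(\<Sum>m<M. (1 / 2) ^ m) = (2 :: real) - 2 * (1 / 2) ^ M"
    by (induction M) auto
  also have "2 * ((2 * r) ^ ?d * (2 - 2 * (1 / 2) ^ M)) \<le> 2 * ((2 * r) ^ ?d * 2)"
    using r by (intro mult_left_mono) auto
  finally show ?thesis using r by (simp add: power_mult_distrib mult_left_mono)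
qed

section \<open>From single frequencies to measures\<close>

lemma measurable_atom_coeff: "atom_coeff k l \<in> borel_measurable borel"
  for k :: "int ^ 'n::finite"
proof -
  have comp: "(\<lambda>\<xi> :: real ^ 'n. \<xi> $ j) \<in> borel_measurable borel" for j
    by (intro borel_measurable_continuous_onI continuous_intros)
  have pred: "{\<xi>. k = lattice_point \<xi>} \<in> sets borel"
  proof -
    note comp [measurable]
    have "{\<xi> \<in> space (borel :: (real ^ 'n) measure). \<forall>j. \<lfloor>\<xi> $ j + 1 / 2\<rfloor> = k $ j} \<in> sets borel"
      by measurable
    also have "{\<xi> \<in> space (borel :: (real ^ 'n) measure). \<forall>j. \<lfloor>\<xi> $ j + 1 / 2\<rfloor> = k $ j} = {\<xi>. k = lattice_point \<xi>}"
      by (auto simp: lattice_point_def vec_eq_iff round_def)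
    finally show ?thesis .
  qed
  have prod: "(\<lambda>\<xi> :: real ^ 'n. prod_list (map (\<lambda>j. \<xi> $ j - of_int (k $ j)) l)) \<in> borel_measurable borel"
    by (induction l) (auto intro!: borel_measurable_times borel_measurable_diff comp)
  \<comment> \<open>In the only branch where the offset matters, \<open>lattice_point \<xi>\<close>
    equals the fixed \<open>k\<close>, so the offset may be replaced by a continuous function of
    \<open>\<xi>\<close>.\<close>
  have "atom_coeff k l = (\<lambda>\<xi>. (if k = lattice_point \<xi>
      then (2 * pi) ^ length l / fact (length l) * prod_list (map (\<lambda>j. \<xi> $ j - of_int (k $ j)) l) else 0)
     - (if k = 0 \<and> l = [] then 1 else 0))"
    by (auto simp: atom_coeff_def lattice_offset_def[abs_def] fun_eq_iff)
  also have "\<dots> \<in> borel_measurable borel"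
    using pred prod
    by (intro borel_measurable_diff measurable_If borel_measurable_times) auto
  finally show ?thesis .
qed

text \<open>The coefficients are the integrals of those of single frequencies. These depend on
  neither \<open>q\<close> nor \<open>x\<close>, so one \<open>b\<close> serves all waves and
  points, and both pointwise estimates are multiples of \<open>norm \<xi>\<close>, hence integrate
  to multiples of \<open>C\<close>.\<close>

lemma wave_integral_approx:
  fixes N :: "(real ^ 'n::finite) measure"
  defines "d \<equiv> real CARD('n)"
  defines "C1 \<equiv> 4 * pi * d\<^sup>2 * exp (2 * pi * d\<^sup>2)"
  assumes sets: "sets N = sets borel" and fin: "(\<integral>\<^sup>+ \<xi>. ennreal (norm \<xi>) \<partial>N) \<le> ennreal C"
    and C: "0 \<le> C" and M: "0 < M" and K: "0 < K"
  shows "\<exists>b. (\<Sum>k\<in>lattice_ball K. \<Sum>l | length l < M. atom_weight k l * \<bar>b k l\<bar>) \<le> C1 * C \<and>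
    (\<forall>q. \<forall>x\<in>cbox 0 1.
      \<bar>(\<integral>\<xi>. wave q (2 * pi * (x \<bullet> \<xi>)) - wave q 0 \<partial>N)
        - (\<Sum>k\<in>lattice_ball K. \<Sum>l | length l < M. b k l * atom q k l x)\<bar>
      \<le> max (1 / K) (2 * (pi * d) ^ M / fact M) * C)"
proof -
  let ?I = "lattice_ball K :: (int ^ 'n) set" and ?L = "{l :: 'n list. length l < M}"
  define b where "b k l = (\<integral>\<xi>. atom_coeff k l \<xi> \<partial>N)" for k :: "int ^ 'n" and l
  have C1: "0 \<le> C1" by (simp add: C1_def)
  have w0: "0 \<le> atom_weight k l" for k :: "int ^ 'n" and l using atom_weight_ge_1[of k l] by simp
  have sum_le: "(\<Sum>k\<in>?I. \<Sum>l\<in>?L. atom_weight k l * \<bar>atom_coeff k l \<xi>\<bar>) \<le> C1 * norm \<xi>" for \<xi>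
    using sum_weight_atom_coeff_le[OF M, where K = K and \<xi> = \<xi>] by (simp add: C1_def d_def)
  have int: "integrable N (atom_coeff k l)" if "k \<in> ?I" "l \<in> ?L" for k l
  proof (rule integrable_norm_bound[OF sets fin measurable_atom_coeff])
    fix \<xi>
    have "norm (atom_coeff k l \<xi>) \<le> atom_weight k l * \<bar>atom_coeff k l \<xi>\<bar>"
      using mult_right_mono[OF atom_weight_ge_1[of k l], of "\<bar>atom_coeff k l \<xi>\<bar>"] by simp
    also have "\<dots> \<le> (\<Sum>l\<in>?L. atom_weight k l * \<bar>atom_coeff k l \<xi>\<bar>)"
      using that w0 by (intro member_le_sum) (auto simp: finite_lists_length_less)
    also have "\<dots> \<le> (\<Sum>k\<in>?I. \<Sum>l\<in>?L. atom_weight k l * \<bar>atom_coeff k l \<xi>\<bar>)"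
      using that w0 by (intro member_le_sum sum_nonneg) (auto simp: finite_lattice_ball)
    also note sum_le
    finally show "norm (atom_coeff k l \<xi>) \<le> C1 * norm \<xi>" .
  qed
  have "(\<Sum>k\<in>?I. \<Sum>l\<in>?L. atom_weight k l * \<bar>b k l\<bar>)
      \<le> (\<Sum>k\<in>?I. \<Sum>l\<in>?L. (\<integral>\<xi>. atom_weight k l * \<bar>atom_coeff k l \<xi>\<bar> \<partial>N))"
    unfolding b_def integral_mult_right_zero
    by (intro sum_mono mult_left_mono integral_abs_bound w0)
  also have "\<dots> = (\<integral>\<xi>. (\<Sum>k\<in>?I. \<Sum>l\<in>?L. atom_weight k l * \<bar>atom_coeff k l \<xi>\<bar>) \<partial>N)"
  proof -
    have int': "integrable N (\<lambda>\<xi>. atom_weight k l * \<bar>atom_coeff k l \<xi>\<bar>)" if "k \<in> ?I" "l \<in> ?L" for k l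
      using int[OF that] by simp
    then have "(\<integral>\<xi>. (\<Sum>k\<in>?I. \<Sum>l\<in>?L. atom_weight k l * \<bar>atom_coeff k l \<xi>\<bar>) \<partial>N)
       = (\<Sum>k\<in>?I. \<integral>\<xi>. (\<Sum>l\<in>?L. atom_weight k l * \<bar>atom_coeff k l \<xi>\<bar>) \<partial>N)"
      by (intro Bochner_Integration.integral_sum Bochner_Integration.integrable_sum) auto
    also have "\<dots> = (\<Sum>k\<in>?I. \<Sum>l\<in>?L. (\<integral>\<xi>. atom_weight k l * \<bar>atom_coeff k l \<xi>\<bar> \<partial>N))"
      using int' by (intro sum.cong refl Bochner_Integration.integral_sum) auto
    finally show ?thesis by simp
  qed
  also have "\<dots> \<le> C1 * C"
  proof -
    have "\<bar>\<integral>\<xi>. (\<Sum>k\<in>?I. \<Sum>l\<in>?L. atom_weight k l * \<bar>atom_coeff k l \<xi>\<bar>) \<partial>N\<bar> \<le> C1 * C"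
    proof (rule abs_integral_le_norm_bound[OF sets fin _ _ C1 C])
      show "(\<lambda>\<xi>. \<Sum>k\<in>?I. \<Sum>l\<in>?L. atom_weight k l * \<bar>atom_coeff k l \<xi>\<bar>) \<in> borel_measurable borel"
        using measurable_atom_coeff
        by (intro borel_measurable_sum borel_measurable_times borel_measurable_abs) auto
      show "\<bar>\<Sum>k\<in>?I. \<Sum>l\<in>?L. atom_weight k l * \<bar>atom_coeff k l \<xi>\<bar>\<bar> \<le> C1 * norm \<xi>" for \<xi>
        using sum_le[of \<xi>] w0 by (subst abs_of_nonneg) (auto intro!: sum_nonneg)
    qed
    then show ?thesis by linarith
  qed
  finally have 1: "(\<Sum>k\<in>?I. \<Sum>l\<in>?L. atom_weight k l * \<bar>b k l\<bar>) \<le> C1 * C" .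
  have 2: "\<bar>(\<integral>\<xi>. wave q (2 * pi * (x \<bullet> \<xi>)) - wave q 0 \<partial>N) - (\<Sum>k\<in>?I. \<Sum>l\<in>?L. b k l * atom q k l x)\<bar>
      \<le> max (1 / K) (2 * (pi * d) ^ M / fact M) * C" if x: "x \<in> cbox 0 1" for q x
  proof -
    have meas: "(\<lambda>\<xi>. wave q (2 * pi * (x \<bullet> \<xi>)) - wave q 0) \<in> borel_measurable borel"
      by measurable
    have int_wave: "integrable N (\<lambda>\<xi>. wave q (2 * pi * (x \<bullet> \<xi>)) - wave q 0)"
    proof (rule integrable_norm_bound[OF sets fin meas])
      fix \<xi>
      have "norm (wave q (2 * pi * (x \<bullet> \<xi>)) - wave q 0) \<le> \<bar>2 * pi * (x \<bullet> \<xi>)\<bar>"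
        using wave_Lipschitz[of q "2 * pi * (x \<bullet> \<xi>)" 0] by simp
      also have "\<dots> \<le> 2 * pi * (norm x * norm \<xi>)"
        using Cauchy_Schwarz_ineq2[of x \<xi>] by (simp add: abs_mult)
      finally show "norm (wave q (2 * pi * (x \<bullet> \<xi>)) - wave q 0) \<le> (2 * pi * norm x) * norm \<xi>"
        by (simp add: mult_ac)
    qed
    have "(\<integral>\<xi>. wave q (2 * pi * (x \<bullet> \<xi>)) - wave q 0 \<partial>N) - (\<Sum>k\<in>?I. \<Sum>l\<in>?L. b k l * atom q k l x)
       = (\<integral>\<xi>. wave q (2 * pi * (x \<bullet> \<xi>)) - wave q 0
            - (\<Sum>k\<in>?I. \<Sum>l\<in>?L. atom_coeff k l \<xi> * atom q k l x) \<partial>N)"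
    proof -
      have eq: "(\<integral>\<xi>. (\<Sum>k\<in>?I. \<Sum>l\<in>?L. atom_coeff k l \<xi> * atom q k l x) \<partial>N)
          = (\<Sum>k\<in>?I. \<Sum>l\<in>?L. b k l * atom q k l x)"
      proof -
        have "(\<integral>\<xi>. (\<Sum>k\<in>?I. \<Sum>l\<in>?L. atom_coeff k l \<xi> * atom q k l x) \<partial>N)
          = (\<Sum>k\<in>?I. \<integral>\<xi>. (\<Sum>l\<in>?L. atom_coeff k l \<xi> * atom q k l x) \<partial>N)"
          using int by (intro Bochner_Integration.integral_sum Bochner_Integration.integrable_sum) auto
        also have "\<dots> = (\<Sum>k\<in>?I. \<Sum>l\<in>?L. (\<integral>\<xi>. atom_coeff k l \<xi> * atom q k l x \<partial>N))"
          using int by (intro sum.cong refl Bochner_Integration.integral_sum) auto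
        finally show ?thesis by (simp add: b_def)
      qed
      have int_sum: "integrable N (\<lambda>\<xi>. \<Sum>k\<in>?I. \<Sum>l\<in>?L. atom_coeff k l \<xi> * atom q k l x)"
        using int by (intro Bochner_Integration.integrable_sum) auto
      show ?thesis
        by (simp only: Bochner_Integration.integral_diff[OF int_wave int_sum] eq)
    qed
    also have "\<bar>\<dots>\<bar> \<le> max (1 / K) (2 * (pi * d) ^ M / fact M) * C"
    proof (rule abs_integral_le_norm_bound[OF sets fin _ _ _ C])
      show "(\<lambda>\<xi>. wave q (2 * pi * (x \<bullet> \<xi>)) - wave q 0
            - (\<Sum>k\<in>?I. \<Sum>l\<in>?L. atom_coeff k l \<xi> * atom q k l x)) \<in> borel_measurable borel"
        using measurable_atom_coeff
        by (intro borel_measurable_diff[OF meas] borel_measurable_sum borel_measurable_times) auto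
      show "\<bar>wave q (2 * pi * (x \<bullet> \<xi>)) - wave q 0
            - (\<Sum>k\<in>?I. \<Sum>l\<in>?L. atom_coeff k l \<xi> * atom q k l x)\<bar>
          \<le> max (1 / K) (2 * (pi * d) ^ M / fact M) * norm \<xi>" for \<xi>
        unfolding d_def by (rule atom_expansion_error[OF x M K])
      show "0 \<le> max (1 / K) (2 * (pi * d) ^ M / fact M)" by (simp add: le_max_iff_disj)
    qed
    finally show ?thesis .
  qed
  show ?thesis using 1 2 by blast
qed

text \<open>The order of quantifiers matters: \<open>K\<close> and \<open>M\<close> are common to
  all functions, so all are expanded over one finite index set, and the norm bound is free of
  \<open>\<eta>\<close>. In that bound \<open>1\<close> pays for the additive constant, and
  \<open>16\<close> is the \<open>4\<close> of a single measure times four measures.\<close>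

lemma general_barron_approx:
  fixes C :: real
  assumes C: "0 < C" and \<eta>: "0 < \<eta>"
  shows "\<exists>K M. 0 < K \<and> 0 < M \<and> (\<forall>f \<in> (general_barron C :: (real ^ 'n::finite \<Rightarrow> real) set).
    \<exists>a. (\<Sum>(q, k, l)\<in>atom_indices K M. atom_weight k l * \<bar>a (q, k, l)\<bar>)
          \<le> C * (1 + 16 * pi * (real CARD('n))\<^sup>2 * exp (2 * pi * (real CARD('n))\<^sup>2)) \<and>
        (\<forall>x\<in>cbox 0 1. \<bar>f x - (\<Sum>(q, k, l)\<in>atom_indices K M. a (q, k, l) * atom q k l x)\<bar> \<le> \<eta>))"
proof -
  define d where "d = real CARD('n)"
  define C1 where "C1 = 4 * pi * d\<^sup>2 * exp (2 * pi * d\<^sup>2)"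
  \<comment> \<open>Each of the four measures may contribute an error of \<open>\<eta>' * C\<close>,
    a quarter of \<open>\<eta>\<close>.\<close>
  define \<eta>' where "\<eta>' = \<eta> / (4 * C)"
  have \<eta>': "0 < \<eta>'" using C \<eta> by (simp add: \<eta>'_def)
  obtain K where K: "0 < K" "1 / real K \<le> \<eta>'"
  proof -
    obtain n where "inverse (real (Suc n)) < \<eta>'" using reals_Archimedean[OF \<eta>'] by blast
    then show ?thesis using that[of "Suc n"] by (simp add: inverse_eq_divide)
  qed
  obtain M where M: "0 < M" "2 * (pi * d) ^ M / fact M \<le> \<eta>'"
  proof -
    have "(\<lambda>n. (pi * d) ^ n / fact n) \<longlonglongrightarrow> 0"
      using summable_LIMSEQ_zero[OF summable_exp[of "pi * d"]] by (simp add: divide_inverse mult.commute)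
    then have "eventually (\<lambda>n. (pi * d) ^ n / fact n < \<eta>' / 2) sequentially"
      using \<eta>' by (intro order_tendstoD) auto
    then obtain n where "\<And>m. n \<le> m \<Longrightarrow> (pi * d) ^ m / fact m < \<eta>' / 2"
      by (auto simp: eventually_sequentially)
    from this[of "Suc n"] show ?thesis
      by (intro that[of "Suc n"]) (auto simp del: power_Suc fact_Suc simp: mult.commute)
  qed
  let ?err = "max (1 / real K) (2 * (pi * d) ^ M / fact M)"
  have err: "?err \<le> \<eta>'" using K M by simp
  let ?I = "lattice_ball K :: (int ^ 'n) set" and ?L = "{l :: 'n list. length l < M}"
  have "\<exists>a. (\<Sum>(q, k, l)\<in>atom_indices K M. atom_weight k l * \<bar>a (q, k, l)\<bar>) \<le> C * (1 + 4 * C1) \<and>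
        (\<forall>x\<in>cbox 0 1. \<bar>f x - (\<Sum>(q, k, l)\<in>atom_indices K M. a (q, k, l) * atom q k l x)\<bar> \<le> \<eta>)"
    if f: "f \<in> general_barron C" for f :: "real ^ 'n \<Rightarrow> real"
  proof -
    obtain c and \<nu> :: "nat \<Rightarrow> nat \<Rightarrow> (real ^ 'n) measure" where
      c: "\<bar>c\<bar> \<le> C" and sets: "\<And>q s. sets (\<nu> q s) = sets borel" and
      fin: "\<And>q s. (\<integral>\<^sup>+ \<xi>. ennreal (norm \<xi>) \<partial>\<nu> q s) \<le> ennreal C" and
      fx: "\<And>x. x \<in> cbox 0 1 \<Longrightarrow>
       f x = c + (\<Sum>q<2. \<Sum>s<2. (- 1) ^ s * (\<integral>\<xi>. wave q (2 * pi * (x \<bullet> \<xi>)) - wave q 0 \<partial>\<nu> q s))"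
      by (rule general_barron_real_form[OF f C], rule that)
    define P where "P q s b \<longleftrightarrow> (\<Sum>k\<in>?I. \<Sum>l\<in>?L. atom_weight k l * \<bar>b k l\<bar>) \<le> C1 * C \<and>
      (\<forall>r. \<forall>x\<in>cbox 0 1. \<bar>(\<integral>\<xi>. wave r (2 * pi * (x \<bullet> \<xi>)) - wave r 0 \<partial>\<nu> q s)
        - (\<Sum>k\<in>?I. \<Sum>l\<in>?L. b k l * atom r k l x)\<bar> \<le> ?err * C)" for q s b
    have "\<exists>b. P q s b" for q s
      unfolding P_def C1_def d_def
      by (rule wave_integral_approx[OF sets fin less_imp_le[OF C] M(1) K(1)])
    then obtain b where P: "\<And>q s. P q s (b q s)" by metis
    have b1: "(\<Sum>k\<in>?I. \<Sum>l\<in>?L. atom_weight k l * \<bar>b q s k l\<bar>) \<le> C1 * C" for q s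
      using P[of q s] unfolding P_def by blast
    have b2: "\<bar>(\<integral>\<xi>. wave r (2 * pi * (x \<bullet> \<xi>)) - wave r 0 \<partial>\<nu> q s)
        - (\<Sum>k\<in>?I. \<Sum>l\<in>?L. b q s k l * atom r k l x)\<bar> \<le> ?err * C" if "x \<in> cbox 0 1" for q s r x
      using P[of q s] that unfolding P_def by blast
    \<comment> \<open>The additive constant is carried by the atom with \<open>q = 0\<close>,
      \<open>k = 0\<close> and \<open>l = []\<close>, which is identically \<open>1\<close> and has
      weight \<open>1\<close>.\<close>
    define e where "e q k l = (if q = 0 \<and> k = 0 \<and> l = [] then c else 0)"
      for q :: nat and k :: "int ^ 'n" and l :: "'n list"
    define a where "a = (\<lambda>(q, k, l). e q k l + (\<Sum>s<2. (- 1) ^ s * b q s k l))"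
    have e_sum: "(\<Sum>q<2. \<Sum>k\<in>?I. \<Sum>l\<in>?L. F q k l * h (e q k l)) = F 0 0 [] * h c"
      if "h 0 = 0" for F :: "nat \<Rightarrow> int ^ 'n \<Rightarrow> 'n list \<Rightarrow> real" and h :: "real \<Rightarrow> real"
    proof -
      have 0: "(0 :: int ^ 'n) \<in> ?I" by (simp add: lattice_ball_def)
      have "(\<Sum>q<2. \<Sum>k\<in>?I. \<Sum>l\<in>?L. F q k l * h (e q k l))
        = (\<Sum>(q, k, l)\<in>atom_indices K M. F q k l * h (e q k l))" by (rule sum_atom_indices[symmetric])
      also have "\<dots> = (\<Sum>i\<in>atom_indices K M. if i = (0, 0 :: int ^ 'n, []) then F 0 0 [] * h c else 0)"
        by (intro sum.cong refl) (auto simp: e_def that split: if_splits prod.splits)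
      also have "\<dots> = F 0 0 [] * h c"
        using 0 M(1) by (subst sum.delta) (auto simp: finite_atom_indices, auto simp: atom_indices_def)
      finally show ?thesis .
    qed
    have "(\<Sum>(q, k, l)\<in>atom_indices K M. atom_weight k l * \<bar>a (q, k, l)\<bar>)
        = (\<Sum>q<2. \<Sum>k\<in>?I. \<Sum>l\<in>?L. atom_weight k l * \<bar>a (q, k, l)\<bar>)"
      by (rule sum_atom_indices)
    also have "\<dots> \<le> (\<Sum>q<2. \<Sum>k\<in>?I. \<Sum>l\<in>?L. atom_weight k l * \<bar>e q k l\<bar>
        + (\<Sum>s<2. atom_weight k l * \<bar>b q s k l\<bar>))"
    proof (intro sum_mono)
      fix q k and l :: "'n list"
      have "\<bar>a (q, k, l)\<bar> \<le> \<bar>e q k l\<bar> + (\<Sum>s<2. \<bar>b q s k l\<bar>)"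
        by (simp add: a_def numeral_2_eq_2)
      then have "atom_weight k l * \<bar>a (q, k, l)\<bar> \<le> atom_weight k l * (\<bar>e q k l\<bar> + (\<Sum>s<2. \<bar>b q s k l\<bar>))"
        using atom_weight_ge_1[of k l] by (intro mult_left_mono) auto
      then show "atom_weight k l * \<bar>a (q, k, l)\<bar> \<le> atom_weight k l * \<bar>e q k l\<bar>
        + (\<Sum>s<2. atom_weight k l * \<bar>b q s k l\<bar>)"
        by (simp only: distrib_left sum_distrib_left)
    qed
    also have "\<dots> = \<bar>c\<bar> + (\<Sum>q<2. \<Sum>s<2. \<Sum>k\<in>?I. \<Sum>l\<in>?L. atom_weight k l * \<bar>b q s k l\<bar>)"
      using e_sum[of abs "\<lambda>q. atom_weight"]
      by (simp add: sum.distrib numeral_2_eq_2 atom_weight_def lattice_norm_0)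
    also have "\<dots> \<le> C + (\<Sum>q<(2::nat). \<Sum>s<(2::nat). C1 * C)"
      by (intro add_mono sum_mono b1 c)
    finally have 1: "(\<Sum>(q, k, l)\<in>atom_indices K M. atom_weight k l * \<bar>a (q, k, l)\<bar>) \<le> C * (1 + 4 * C1)"
      by (simp add: algebra_simps)
    have 2: "\<bar>f x - (\<Sum>(q, k, l)\<in>atom_indices K M. a (q, k, l) * atom q k l x)\<bar> \<le> \<eta>"
      if x: "x \<in> cbox 0 1" for x
    proof -
      let ?W = "\<lambda>q s. \<integral>\<xi>. wave q (2 * pi * (x \<bullet> \<xi>)) - wave q 0 \<partial>\<nu> q s"
      let ?S = "\<lambda>q s. \<Sum>k\<in>?I. \<Sum>l\<in>?L. b q s k l * atom q k l x"
      have "(\<Sum>(q, k, l)\<in>atom_indices K M. a (q, k, l) * atom q k l x)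
        = (\<Sum>q<2. \<Sum>k\<in>?I. \<Sum>l\<in>?L. a (q, k, l) * atom q k l x)" by (rule sum_atom_indices)
      also have "\<dots> = (\<Sum>q<2. \<Sum>k\<in>?I. \<Sum>l\<in>?L. atom q k l x * e q k l
          + (b q 0 k l * atom q k l x - b q 1 k l * atom q k l x))"
        by (intro sum.cong refl) (simp add: a_def numeral_2_eq_2 algebra_simps)
      also have "\<dots> = c + (\<Sum>q<2. ?S q 0 - ?S q 1)"
        using e_sum[of "\<lambda>x. x" "\<lambda>q k l. atom q k l x"]
        by (simp add: sum.distrib sum_subtractf atom_def wave_simps)
      finally have eq: "f x - (\<Sum>(q, k, l)\<in>atom_indices K M. a (q, k, l) * atom q k l x)
        = (?W 0 0 - ?S 0 0) - (?W 0 1 - ?S 0 1) + (?W 1 0 - ?S 1 0) - (?W 1 1 - ?S 1 1)"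
        by (simp add: fx[OF x] numeral_2_eq_2)
      have bound: "\<bar>?W q s - ?S q s\<bar> \<le> \<eta> / 4" for q s
      proof -
        have "?err * C \<le> \<eta>' * C" using err C by (intro mult_right_mono) auto
        then show ?thesis using b2[OF x, where q = q and s = s and r = q] C by (simp add: \<eta>'_def)
      qed
      show ?thesis
        unfolding eq using bound[of 0 0] bound[of 0 1] bound[of 1 0] bound[of 1 1] by linarith
    qed
    show ?thesis using 1 2 by blast
  qed
  then show ?thesis
    using K(1) M(1) by (intro exI[of _ K] exI[of _ M]) (simp add: C1_def d_def mult_ac)
qed

section \<open>Derandomized rounding\<close>

text \<open>Method of conditional expectations: the coordinates are fixed one after the other, never
  increasing the expectation of the potential.\<close>

lemma exists_le_expectation:
  fixes \<phi> :: "'g \<Rightarrow> 'i \<Rightarrow> bool \<Rightarrow> real" and \<psi> :: "'i \<Rightarrow> bool \<Rightarrow> real"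
  assumes "finite S" and p: "\<And>i. i \<in> S \<Longrightarrow> 0 \<le> p i \<and> p i \<le> 1"
  shows "\<exists>e. (\<Sum>g\<in>G. \<alpha> g * (\<Prod>i\<in>S. \<phi> g i (e i))) + (\<Sum>i\<in>S. \<psi> i (e i))
    \<le> (\<Sum>g\<in>G. \<alpha> g * (\<Prod>i\<in>S. p i * \<phi> g i True + (1 - p i) * \<phi> g i False))
      + (\<Sum>i\<in>S. p i * \<psi> i True + (1 - p i) * \<psi> i False)"
  using assms
proof (induction S arbitrary: \<alpha> rule: finite_induct)
  case (insert k S)
  let ?E = "\<lambda>g i. p i * \<phi> g i True + (1 - p i) * \<phi> g i False"
  \<comment> \<open>The conditional expectation once coordinate \<open>k\<close> is fixed to
    \<open>v\<close>; the full expectation averages its two values, so one of them does not exceed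
    it. The factor of the fixed coordinate joins \<open>\<alpha>\<close>, which is why the induction
    keeps \<open>\<alpha>\<close> arbitrary.\<close>
  define F where "F v = (\<Sum>g\<in>G. \<alpha> g * \<phi> g k v * (\<Prod>i\<in>S. ?E g i)) + \<psi> k v
      + (\<Sum>i\<in>S. p i * \<psi> i True + (1 - p i) * \<psi> i False)" for v
  have pk: "0 \<le> p k" "p k \<le> 1" using insert.prems[of k] by auto
  have avg: "(\<Sum>g\<in>G. \<alpha> g * (\<Prod>i\<in>insert k S. ?E g i))
      + (\<Sum>i\<in>insert k S. p i * \<psi> i True + (1 - p i) * \<psi> i False)
      = p k * F True + (1 - p k) * F False"
    using insert.hyps
    by (simp add: F_def algebra_simps sum.distrib sum_subtractf sum_distrib_left)
  have "\<exists>v. F v \<le> p k * F True + (1 - p k) * F False"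
  proof (rule ccontr)
    assume "\<not> ?thesis"
    then have lt: "p k * F True + (1 - p k) * F False < F True"
      "p k * F True + (1 - p k) * F False < F False" by (auto simp: not_le)
    have "p k * (p k * F True + (1 - p k) * F False) + (1 - p k) * (p k * F True + (1 - p k) * F False)
        < p k * F True + (1 - p k) * F False"
    proof (cases "p k = 0")
      case True
      then show ?thesis using lt by simp
    next
      case False
      then have "p k * (p k * F True + (1 - p k) * F False) < p k * F True"
        using pk lt(1) by simp
      moreover have "(1 - p k) * (p k * F True + (1 - p k) * F False) \<le> (1 - p k) * F False"
        using pk lt(2) by (intro mult_left_mono) auto
      ultimately show ?thesis by simp
    qed
    then show False by (simp add: algebra_simps)
  qed
  then obtain v where v: "F v \<le> p k * F True + (1 - p k) * F False" ..
  obtain e where e: "(\<Sum>g\<in>G. \<alpha> g * \<phi> g k v * (\<Prod>i\<in>S. \<phi> g i (e i))) + (\<Sum>i\<in>S. \<psi> i (e i))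
      \<le> (\<Sum>g\<in>G. \<alpha> g * \<phi> g k v * (\<Prod>i\<in>S. ?E g i)) + (\<Sum>i\<in>S. p i * \<psi> i True + (1 - p i) * \<psi> i False)"
    using insert.IH[of "\<lambda>g. \<alpha> g * \<phi> g k v"] insert.prems by auto
  have prod_upd: "(\<Prod>i\<in>S. \<phi> g i ((e(k := v)) i)) = (\<Prod>i\<in>S. \<phi> g i (e i))" for g
    using insert.hyps by (intro prod.cong) auto
  have sum_upd: "(\<Sum>i\<in>S. \<psi> i ((e(k := v)) i)) = (\<Sum>i\<in>S. \<psi> i (e i))"
    using insert.hyps by (intro sum.cong) auto
  have "(\<Sum>g\<in>G. \<alpha> g * (\<Prod>i\<in>insert k S. \<phi> g i ((e(k := v)) i))) + (\<Sum>i\<in>insert k S. \<psi> i ((e(k := v)) i))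
     = (\<Sum>g\<in>G. \<alpha> g * \<phi> g k v * (\<Prod>i\<in>S. \<phi> g i (e i))) + (\<Sum>i\<in>S. \<psi> i (e i)) + \<psi> k v"
    using insert.hyps by (simp add: prod_upd sum_upd mult.assoc del: fun_upd_apply) simp
  also have "\<dots> \<le> F v" using e by (simp add: F_def)
  also note v
  finally show ?case unfolding avg by blast
qed simp

lemma exp_le_quadratic:
  fixes z :: real
  assumes "\<bar>z\<bar> \<le> 1"
  shows "exp z \<le> 1 + z + 2 * z\<^sup>2"
proof -
  obtain t where t: "\<bar>t\<bar> \<le> \<bar>z\<bar>" "exp z = (\<Sum>m<2. z ^ m / fact m) + exp t / fact 2 * z\<^sup>2"
    using Maclaurin_exp_le[of z 2] by auto
  have "exp t \<le> exp 1" using t(1) assms by simp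
  then have "exp t \<le> 4" using exp_le by linarith
  then have "exp t / fact 2 \<le> 2" by simp
  then have "exp t / fact 2 * z\<^sup>2 \<le> 2 * z\<^sup>2" by (rule mult_right_mono) simp
  then show ?thesis using t(2) by (simp add: numeral_2_eq_2)
qed

text \<open>The factor \<open>p\<close> in the exponent is essential: a bound by the range alone
  would charge a full squared step even to coefficients far below the step size, whereas here they
  pay in proportion to their size.\<close>

lemma centered_Bernoulli_mgf:
  fixes p y :: real
  assumes p: "0 \<le> p" "p \<le> 1" and y: "\<bar>y\<bar> \<le> 1"
  shows "p * exp (y * (p - 1)) + (1 - p) * exp (y * p) \<le> exp (2 * y\<^sup>2 * p)"
proof -
  have "\<bar>y * (p - 1)\<bar> \<le> 1" "\<bar>y * p\<bar> \<le> 1"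
    using p y by (auto simp: abs_mult intro!: mult_le_one)
  then have "p * exp (y * (p - 1)) + (1 - p) * exp (y * p)
      \<le> p * (1 + y * (p - 1) + 2 * (y * (p - 1))\<^sup>2) + (1 - p) * (1 + y * p + 2 * (y * p)\<^sup>2)"
    using p by (intro add_mono mult_left_mono exp_le_quadratic) auto
  also have "\<dots> = 1 + 2 * y\<^sup>2 * p * (1 - p)" by (simp add: power2_eq_square algebra_simps)
  also have "\<dots> \<le> 1 + 2 * y\<^sup>2 * p * 1"
    using p by (intro add_left_mono mult_left_mono) auto
  also have "\<dots> \<le> exp (2 * y\<^sup>2 * p)" by (simp add: exp_ge_add_one_self)
  finally show ?thesis .
qed

text \<open>Each \<open>\<bar>a i\<bar> / \<delta>\<close> is rounded up with probability equal to
  its fractional part, so errors are centred, and \<open>lam * \<delta> \<le> 1\<close> keeps the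
  exponents where \<open>exp\<close> has its quadratic bound. One potential of expectation at most
  \<open>2\<close> controls norm and errors together: this gives the \<open>2\<close> in
  \<open>2 * A / \<delta>\<close>, and with two signs per grid point the \<open>4\<close> in the
  logarithm.\<close>

lemma integer_rounding:
  fixes a w :: "'i \<Rightarrow> real" and c :: "'x \<Rightarrow> 'i \<Rightarrow> real"
  assumes S: "finite S" and G: "finite G" "G \<noteq> {}" and \<delta>: "0 < \<delta>" and lam: "0 < lam" "lam * \<delta> \<le> 1"
    and c: "\<And>x i. x \<in> G \<Longrightarrow> i \<in> S \<Longrightarrow> \<bar>c x i\<bar> \<le> 1"
    and w: "\<And>i. i \<in> S \<Longrightarrow> 0 \<le> w i" and A: "0 < A" "(\<Sum>i\<in>S. w i * \<bar>a i\<bar>) \<le> A"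
    and V: "(\<Sum>i\<in>S. min (\<delta>\<^sup>2) (\<delta> * \<bar>a i\<bar>)) \<le> V"
  shows "\<exists>b :: 'i \<Rightarrow> int. (\<Sum>i\<in>S. w i * \<bar>of_int (b i)\<bar>) \<le> 2 * A / \<delta> \<and>
    (\<forall>x\<in>G. \<bar>\<Sum>i\<in>S. (a i - \<delta> * of_int (b i)) * c x i\<bar> \<le> ln (4 * real (card G)) / lam + 2 * lam * V)"
proof -
  define n where "n i = \<lfloor>\<bar>a i\<bar> / \<delta>\<rfloor>" for i
  define p where "p i = frac (\<bar>a i\<bar> / \<delta>)" for i
  define \<sigma> :: "'i \<Rightarrow> int" where "\<sigma> i = (if a i < 0 then - 1 else 1)" for i
  define b where "b i v = \<sigma> i * (n i + (if v then 1 else 0))" for i v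
  have p01: "0 \<le> p i" "p i \<le> 1" for i
    using frac_lt_1[of "\<bar>a i\<bar> / \<delta>"] by (auto simp: p_def)
  have n0: "0 \<le> n i" for i using \<delta> by (simp add: n_def)
  have np: "\<bar>a i\<bar> = \<delta> * (of_int (n i) + p i)" for i
    using \<delta> by (simp add: n_def p_def frac_def)
  have p_le: "\<delta> * p i \<le> \<bar>a i\<bar>" for i
    unfolding np using \<delta> n0[of i] by (simp add: distrib_left)
  have a_eq: "a i = of_int (\<sigma> i) * (\<delta> * (of_int (n i) + p i))" for i
    unfolding np[symmetric] by (simp add: \<sigma>_def)
  have diff: "a i - \<delta> * of_int (b i v) = of_int (\<sigma> i) * \<delta> * (p i - (if v then 1 else 0))" for i v
    by (subst a_eq) (simp add: b_def algebra_simps)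
  have b_abs: "\<bar>of_int (b i v)\<bar> = of_int (n i) + (if v then 1 else (0 :: real))" for i v
    using n0[of i] by (simp add: b_def \<sigma>_def abs_mult)
  have card0: "0 < real (card G)" using G by (simp add: card_gt_0_iff)
  define sgns where "sgns = {1, - 1 :: real}"
  define \<phi> where "\<phi> g i v = exp (lam * snd g * (a i - \<delta> * of_int (b i v)) * c (fst g) i)"
    for g :: "'x \<times> real" and i v
  \<comment> \<open>The potential adds normalized exponential moments of the signed errors and the weighted norm of
    the rounded vector; each part has expectation at most \<open>1\<close>.\<close>
  define \<psi> where "\<psi> i v = w i * \<bar>of_int (b i v)\<bar> * (\<delta> / A)" for i v
  define \<kappa> where "\<kappa> = 1 / (2 * real (card G) * exp (2 * lam\<^sup>2 * V))"
  have \<kappa>: "0 < \<kappa>" using card0 by (simp add: \<kappa>_def)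
  have E\<phi>: "p i * \<phi> g i True + (1 - p i) * \<phi> g i False \<le> exp (2 * lam\<^sup>2 * min (\<delta>\<^sup>2) (\<delta> * \<bar>a i\<bar>))"
    if g: "g \<in> G \<times> sgns" and i: "i \<in> S" for g i
  proof -
    define y where "y = lam * \<delta> * (snd g * of_int (\<sigma> i) * c (fst g) i)"
    have "\<bar>snd g * of_int (\<sigma> i) * c (fst g) i\<bar> \<le> 1"
      using c[of "fst g" i] g i by (auto simp: abs_mult sgns_def \<sigma>_def)
    then have y: "\<bar>y\<bar> \<le> lam * \<delta>"
      unfolding y_def using lam \<delta> by (subst abs_mult) (auto intro: mult_left_le)
    then have y1: "\<bar>y\<bar> \<le> 1" using lam by simp
    have y2: "y\<^sup>2 \<le> lam\<^sup>2 * \<delta>\<^sup>2"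
      using power_mono[OF y, of 2] by (simp add: power_mult_distrib)
    have "p i * \<phi> g i True + (1 - p i) * \<phi> g i False = p i * exp (y * (p i - 1)) + (1 - p i) * exp (y * p i)"
      unfolding \<phi>_def diff y_def by (simp add: mult_ac)
    also have "\<dots> \<le> exp (2 * y\<^sup>2 * p i)" by (rule centered_Bernoulli_mgf[OF p01 y1])
    \<comment> \<open>Both entries of the minimum are reached separately: \<open>p i \<le> 1\<close>
      gives the first, \<open>\<delta> * p i \<le> \<bar>a i\<bar>\<close> the second.\<close>
    also have "\<dots> \<le> exp (2 * (lam\<^sup>2 * min (\<delta>\<^sup>2) (\<delta> * \<bar>a i\<bar>)))"
    proof -
      have "y\<^sup>2 * p i \<le> lam\<^sup>2 * \<delta>\<^sup>2 * 1" using y2 p01[of i] by (intro mult_mono) auto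
      moreover have "y\<^sup>2 * p i \<le> lam\<^sup>2 * \<delta>\<^sup>2 * p i" using y2 p01[of i] by (intro mult_right_mono) auto
      moreover have "lam\<^sup>2 * \<delta>\<^sup>2 * p i \<le> lam\<^sup>2 * (\<delta> * \<bar>a i\<bar>)"
        using mult_left_mono[OF p_le[of i], of "lam\<^sup>2 * \<delta>"] \<delta> by (simp add: power2_eq_square mult_ac)
      ultimately have "y\<^sup>2 * p i \<le> lam\<^sup>2 * min (\<delta>\<^sup>2) (\<delta> * \<bar>a i\<bar>)" by (simp add: min_def)
      then show ?thesis by simp
    qed
    finally show ?thesis by (simp only: mult.assoc)
  qed
  have prod_le: "(\<Prod>i\<in>S. p i * \<phi> g i True + (1 - p i) * \<phi> g i False) \<le> exp (2 * lam\<^sup>2 * V)"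
    if g: "g \<in> G \<times> sgns" for g
  proof -
    have "(\<Prod>i\<in>S. p i * \<phi> g i True + (1 - p i) * \<phi> g i False)
        \<le> (\<Prod>i\<in>S. exp (2 * lam\<^sup>2 * min (\<delta>\<^sup>2) (\<delta> * \<bar>a i\<bar>)))"
    proof (intro prod_mono conjI)
      fix i assume "i \<in> S"
      then show "p i * \<phi> g i True + (1 - p i) * \<phi> g i False \<le> exp (2 * lam\<^sup>2 * min (\<delta>\<^sup>2) (\<delta> * \<bar>a i\<bar>))"
        by (rule E\<phi>[OF g])
      show "0 \<le> p i * \<phi> g i True + (1 - p i) * \<phi> g i False"
        using p01[of i] by (auto simp: \<phi>_def intro!: add_nonneg_nonneg)
    qed
    also have "\<dots> = exp (2 * lam\<^sup>2 * (\<Sum>i\<in>S. min (\<delta>\<^sup>2) (\<delta> * \<bar>a i\<bar>)))"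
      using S by (simp add: exp_sum sum_distrib_left)
    also have "\<dots> \<le> exp (2 * lam\<^sup>2 * V)" using V by (simp add: mult_left_mono)
    finally show ?thesis .
  qed
  obtain e where e: "(\<Sum>g\<in>G \<times> sgns. \<kappa> * (\<Prod>i\<in>S. \<phi> g i (e i))) + (\<Sum>i\<in>S. \<psi> i (e i))
    \<le> (\<Sum>g\<in>G \<times> sgns. \<kappa> * (\<Prod>i\<in>S. p i * \<phi> g i True + (1 - p i) * \<phi> g i False))
      + (\<Sum>i\<in>S. p i * \<psi> i True + (1 - p i) * \<psi> i False)"
    using exists_le_expectation[OF S, where p = p and G = "G \<times> sgns" and \<alpha> = "\<lambda>_. \<kappa>" and \<phi> = \<phi> and \<psi> = \<psi>] p01 by blast
  have "(\<Sum>g\<in>G \<times> sgns. \<kappa> * (\<Prod>i\<in>S. p i * \<phi> g i True + (1 - p i) * \<phi> g i False))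
      \<le> (\<Sum>g\<in>G \<times> sgns. \<kappa> * exp (2 * lam\<^sup>2 * V))"
    using \<kappa> prod_le by (intro sum_mono mult_left_mono) auto
  also have "\<dots> = 1" using card0 by (simp add: \<kappa>_def sgns_def card_cartesian_product)
  finally have le1: "(\<Sum>g\<in>G \<times> sgns. \<kappa> * (\<Prod>i\<in>S. p i * \<phi> g i True + (1 - p i) * \<phi> g i False)) \<le> 1" .
  \<comment> \<open>Rounding keeps the sign of \<open>a i\<close>, so the mean of the rounded
    absolute value is exactly \<open>\<bar>a i\<bar> / \<delta>\<close>.\<close>
  have "(\<Sum>i\<in>S. p i * \<psi> i True + (1 - p i) * \<psi> i False) = (\<Sum>i\<in>S. w i * \<bar>a i\<bar>) / A"
    unfolding sum_divide_distrib
    by (intro sum.cong refl) (use A in \<open>simp add: \<psi>_def b_abs np field_simps\<close>)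
  also have "\<dots> \<le> 1" using A by simp
  finally have total: "(\<Sum>g\<in>G \<times> sgns. \<kappa> * (\<Prod>i\<in>S. \<phi> g i (e i))) + (\<Sum>i\<in>S. \<psi> i (e i)) \<le> 2"
    using e le1 by linarith
  have \<phi>0: "0 \<le> \<kappa> * (\<Prod>i\<in>S. \<phi> g i (e i))" for g
    using \<kappa> by (auto simp: \<phi>_def intro!: mult_nonneg_nonneg prod_nonneg)
  have \<psi>0: "0 \<le> (\<Sum>i\<in>S. \<psi> i (e i))"
    using w A \<delta> by (auto simp: \<psi>_def intro!: sum_nonneg)
  have "0 \<le> (\<Sum>g\<in>G \<times> sgns. \<kappa> * (\<Prod>i\<in>S. \<phi> g i (e i)))"
    by (rule sum_nonneg) (rule \<phi>0)
  then have "(\<Sum>i\<in>S. \<psi> i (e i)) \<le> 2" using total by linarith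
  moreover have "(\<Sum>i\<in>S. \<psi> i (e i)) = (\<Sum>i\<in>S. w i * \<bar>of_int (b i (e i))\<bar>) * (\<delta> / A)"
    unfolding \<psi>_def sum_distrib_right ..
  ultimately have 1: "(\<Sum>i\<in>S. w i * \<bar>of_int (b i (e i))\<bar>) \<le> 2 * A / \<delta>"
    using A \<delta> by (simp add: field_simps)
  have 2: "\<bar>\<Sum>i\<in>S. (a i - \<delta> * of_int (b i (e i))) * c x i\<bar> \<le> ln (4 * real (card G)) / lam + 2 * lam * V"
    if x: "x \<in> G" for x
  proof -
    let ?Y = "\<Sum>i\<in>S. (a i - \<delta> * of_int (b i (e i))) * c x i"
    have "s * ?Y \<le> ln (4 * real (card G)) / lam + 2 * lam * V" if s: "s \<in> sgns" for s
    proof -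
      have "\<kappa> * (\<Prod>i\<in>S. \<phi> (x, s) i (e i)) \<le> (\<Sum>g\<in>G \<times> sgns. \<kappa> * (\<Prod>i\<in>S. \<phi> g i (e i)))"
        using x s G \<phi>0 by (intro member_le_sum) (auto simp: sgns_def)
      then have "\<kappa> * (\<Prod>i\<in>S. \<phi> (x, s) i (e i)) \<le> 2" using total \<psi>0 by linarith
      moreover have "(\<Prod>i\<in>S. \<phi> (x, s) i (e i)) = exp (lam * (s * ?Y))"
        unfolding \<phi>_def using S by (simp add: exp_sum[symmetric] sum_distrib_left mult_ac)
      ultimately have "exp (lam * (s * ?Y)) \<le> 4 * real (card G) * exp (2 * lam\<^sup>2 * V)"
        using card0 by (simp add: \<kappa>_def field_simps)
      also have "\<dots> = exp (ln (4 * real (card G)) + 2 * lam\<^sup>2 * V)"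
        using card0 by (simp add: exp_add)
      finally have "lam * (s * ?Y) \<le> ln (4 * real (card G)) + 2 * lam\<^sup>2 * V" by simp
      then show ?thesis using lam by (simp add: field_simps power2_eq_square)
    qed
    from this[of 1] this[of "- 1"] show ?thesis by (simp add: sgns_def abs_le_iff)
  qed
  show ?thesis using 1 2 by (intro exI[of _ "\<lambda>i. b i (e i)"]) auto
qed

section \<open>Counting weighted integer vectors\<close>

lemma sum_power_abs_le:
  fixes q :: real
  assumes "0 \<le> q" "q < 1"
  shows "(\<Sum>k\<in>{- int N..int N}. q ^ nat \<bar>k\<bar>) \<le> (1 + q) / (1 - q)"
proof -
  have "(\<Sum>k\<in>{- int N..int N}. q ^ nat \<bar>k\<bar>) * (1 - q) = 1 + q - 2 * q ^ Suc N"
  proof (induction N)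
    case (Suc N)
    have "{- int (Suc N)..int (Suc N)} = insert (- int (Suc N)) (insert (int (Suc N)) {- int N..int N})"
      by auto
    then have eq: "(\<Sum>k\<in>{- int (Suc N)..int (Suc N)}. q ^ nat \<bar>k\<bar>)
        = 2 * q ^ Suc N + (\<Sum>k\<in>{- int N..int N}. q ^ nat \<bar>k\<bar>)"
      by (simp del: power_Suc of_nat_Suc)
    show ?case unfolding eq distrib_right Suc.IH by (simp add: algebra_simps)
  qed (simp add: algebra_simps)
  also have "\<dots> \<le> 1 + q" using assms by simp
  finally show ?thesis using assms by (simp add: pos_le_divide_eq)
qed

text \<open>Iterates \<open>(1 + q) / (1 - q) = (1 + q)\<^sup>2 / (1 + q\<^sup>2) \<cdot> (1 + q\<^sup>2) / (1 - q\<^sup>2)\<close>.\<close>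

lemma ratio_le_exp_sum_powers:
  fixes q :: real
  assumes "0 \<le> q" "q < 1" "q ^ 2 ^ J \<le> 1 / 2"
  shows "(1 + q) / (1 - q) \<le> exp (4 * (\<Sum>j\<le>J. q ^ 2 ^ j))"
  using assms
proof (induction J arbitrary: q)
  case 0
  then have q: "0 \<le> q" "q \<le> 1 / 2" by auto
  \<comment> \<open>Squaring stops once the argument is at most \<open>1 / 2\<close>, where the
    ratio is still linearly bounded.\<close>
  have "(1 + q) / (1 - q) \<le> 1 + 4 * q"
  proof -
    have "4 * q * q \<le> 4 * q * (1 / 2)" using q by (intro mult_left_mono) auto
    then have "1 + q \<le> (1 + 4 * q) * (1 - q)" by (simp add: algebra_simps)
    then show ?thesis using q by (simp add: pos_divide_le_eq)
  qed
  also have "\<dots> \<le> exp (4 * q)" by (rule exp_ge_add_one_self)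
  finally show ?case by simp
next
  case (Suc J)
  have q2: "0 \<le> q\<^sup>2" "q\<^sup>2 < 1" "(q\<^sup>2) ^ 2 ^ J \<le> 1 / 2"
    using Suc.prems by (auto simp: power_less_one_iff abs_square_less_1 power_mult[symmetric])
  have "(1 + q) / (1 - q) = (1 + q)\<^sup>2 / (1 + q\<^sup>2) * ((1 + q\<^sup>2) / (1 - q\<^sup>2))"
  proof -
    have "1 - q\<^sup>2 = (1 - q) * (1 + q)" by (simp add: power2_eq_square algebra_simps)
    moreover have "1 + q\<^sup>2 \<noteq> 0" using q2 by linarith
    ultimately show ?thesis using Suc.prems by (simp add: power2_eq_square)
  qed
  also have "\<dots> \<le> exp (2 * q) * exp (4 * (\<Sum>j\<le>J. (q\<^sup>2) ^ 2 ^ j))"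
  proof (intro mult_mono Suc.IH q2)
    have "(1 + q)\<^sup>2 / (1 + q\<^sup>2) \<le> (1 + q)\<^sup>2 / 1"
      using q2(1) by (intro divide_left_mono) (auto intro: add_pos_nonneg)
    also have "\<dots> \<le> (exp q)\<^sup>2"
      using Suc.prems by (simp add: power_mono)
    finally show "(1 + q)\<^sup>2 / (1 + q\<^sup>2) \<le> exp (2 * q)" by (simp add: exp_double)
  qed (use q2 in auto)
  also have "\<dots> \<le> exp (4 * (\<Sum>j\<le>Suc J. q ^ 2 ^ j))"
    using Suc.prems(1)
    unfolding sum.atMost_Suc_shift
    by (simp add: exp_add[symmetric] power_mult[symmetric])
  finally show ?case .
qed

text \<open>Arises from \<open>(n + 1) ^ d \<le> d! * 2 ^ d * exp ((n + 1) / 2)\<close>, one term of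
  the exponential series, followed by a geometric series of ratio
  \<open>exp (- 1/2)\<close>.\<close>

definition laplace_const :: "nat \<Rightarrow> real" where
  "laplace_const d = fact d * 2 ^ d * exp (1 / 2) / (1 - exp (- (1 / 2)))"

lemma laplace_const_pos: "0 < laplace_const d"
  by (simp add: laplace_const_def)

lemma sum_exp_power_le: "(\<Sum>n<N. exp (- real n) * (real n + 1) ^ d) \<le> laplace_const d"
proof -
  have bound: "exp (- real n) * (real n + 1) ^ d \<le> fact d * 2 ^ d * exp (1 / 2) * exp (- (1 / 2)) ^ n" for n
  proof -
    let ?y = "(real n + 1) / 2"
    have "?y ^ d / fact d \<le> (\<Sum>m<Suc d. ?y ^ m / fact m)"
      by (rule member_le_sum) auto
    also have "\<dots> \<le> exp ?y"
      using Maclaurin_exp_le[of ?y "Suc d"] by force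
    finally have "(real n + 1) ^ d \<le> fact d * 2 ^ d * exp ?y"
      by (simp add: field_simps power_divide)
    then have "exp (- real n) * (real n + 1) ^ d \<le> exp (- real n) * (fact d * 2 ^ d * exp ?y)"
      by (intro mult_left_mono) auto
    also have "\<dots> = fact d * 2 ^ d * (exp (- real n) * exp ?y)" by (simp add: mult_ac)
    also have "exp (- real n) * exp ?y = exp (1 / 2) * exp (- (1 / 2)) ^ n"
      by (simp add: exp_add[symmetric] exp_of_nat_mult[symmetric] field_simps)
    finally show ?thesis by (simp add: mult_ac)
  qed
  have "(\<Sum>n<N. exp (- real n) * (real n + 1) ^ d) \<le> (\<Sum>n<N. fact d * 2 ^ d * exp (1 / 2) * exp (- (1 / 2)) ^ n)"
    by (intro sum_mono bound)
  also have "\<dots> = fact d * 2 ^ d * exp (1 / 2) * (\<Sum>n<N. exp (- (1 / 2)) ^ n)"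
    by (rule sum_distrib_left[symmetric])
  also have "(\<Sum>n<N. exp (- (1 / 2)) ^ n) \<le> 1 / (1 - exp (- (1 / 2) :: real))"
  proof -
    have "(\<Sum>n<N. exp (- (1 / 2)) ^ n) = (1 - exp (- (1 / 2)) ^ N) / (1 - exp (- (1 / 2) :: real))"
      by (rule sum_gp_strict[THEN trans]) simp
    also have "\<dots> \<le> 1 / (1 - exp (- (1 / 2) :: real))"
      by (intro divide_right_mono) auto
    finally show ?thesis .
  qed
  finally show ?thesis by (simp add: laplace_const_def)
qed

text \<open>Each index is charged \<open>exp (- n)\<close>, where \<open>n\<close> is the integer
  part of \<open>t * w i\<close>; the indices with that integer part lie in the sublevel set counted
  by the hypothesis.\<close>

lemma sum_exp_weight_le:
  fixes w :: "'i \<Rightarrow> real"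
  assumes S: "finite S" and w: "\<And>i. i \<in> S \<Longrightarrow> 0 < w i" and t: "0 < t" and "0 \<le> A"
    and card_le: "\<And>r. 0 < r \<Longrightarrow> real (card {i \<in> S. w i \<le> r}) \<le> A * r ^ d"
  shows "(\<Sum>i\<in>S. exp (- t * w i)) \<le> A * laplace_const d / t ^ d"
proof -
  \<comment> \<open>Large enough to exceed every integer part that occurs; the final estimate does
    not see it.\<close>
  define N where "N = Suc (nat \<lceil>Max (insert 0 ((\<lambda>i. t * w i) ` S))\<rceil>)"
  have "exp (- t * w i) \<le> (\<Sum>n<N. if w i \<le> (real n + 1) / t then exp (- real n) else 0)" if i: "i \<in> S" for i
  proof -
    define m where "m = nat \<lfloor>t * w i\<rfloor>"
    have tw: "0 < t * w i" using w[OF i] t by simp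
    have m: "real m \<le> t * w i" "t * w i \<le> real m + 1" using tw unfolding m_def by linarith+
    have "t * w i \<le> Max (insert 0 ((\<lambda>i. t * w i) ` S))" using S i by (intro Max_ge) auto
    then have "m < N" unfolding m_def N_def by (simp add: less_Suc_eq_le) (linarith)
    have "exp (- t * w i) \<le> (if w i \<le> (real m + 1) / t then exp (- real m) else 0)"
      using m t by (simp add: pos_le_divide_eq mult.commute)
    also have "\<dots> \<le> (\<Sum>n<N. if w i \<le> (real n + 1) / t then exp (- real n) else 0)"
      using \<open>m < N\<close> by (intro member_le_sum) auto
    finally show ?thesis .
  qed
  then have "(\<Sum>i\<in>S. exp (- t * w i)) \<le> (\<Sum>i\<in>S. \<Sum>n<N. if w i \<le> (real n + 1) / t then exp (- real n) else 0)"
    by (rule sum_mono)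
  also have "\<dots> = (\<Sum>n<N. \<Sum>i\<in>S. if w i \<le> (real n + 1) / t then exp (- real n) else 0)"
    by (rule sum.swap)
  also have "\<dots> = (\<Sum>n<N. exp (- real n) * real (card {i \<in> S. w i \<le> (real n + 1) / t}))"
    using S by (simp add: sum.If_cases Int_def mult.commute)
  also have "\<dots> \<le> (\<Sum>n<N. exp (- real n) * (A * ((real n + 1) / t) ^ d))"
    using t by (intro sum_mono mult_left_mono card_le) auto
  also have "\<dots> = A / t ^ d * (\<Sum>n<N. exp (- real n) * (real n + 1) ^ d)"
    by (simp add: sum_distrib_left power_divide mult_ac)
  also have "\<dots> \<le> A / t ^ d * laplace_const d"
    using \<open>0 \<le> A\<close> t by (intro mult_left_mono sum_exp_power_le) auto
  finally show ?thesis by simp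
qed

text \<open>An admissible vector satisfies
  \<open>exp ((T - \<Sum> w \<bar>b\<bar>) / R) \<ge> 1\<close>, and the sum of these exponentials
  over all vectors factorizes into the ratios \<open>(1 + q) / (1 - q)\<close>. Their dyadic
  expansion yields exponential sums over the weights at the scales \<open>2 ^ j / R\<close>; the
  \<open>j\<close>-th is at most a constant times \<open>R ^ d / 2 ^ j\<close>, so all scales
  together cost only twice the first.\<close>

lemma card_weighted_integer_vectors:
  fixes w :: "'i \<Rightarrow> real"
  defines "B \<equiv> \<lambda>S T. {b \<in> S \<rightarrow>\<^sub>E (UNIV :: int set). (\<Sum>i\<in>S. w i * \<bar>of_int (b i)\<bar>) \<le> T}"
  assumes S: "finite S" and w: "\<And>i. i \<in> S \<Longrightarrow> 1 \<le> w i" and R: "0 < R" and "0 \<le> A" and d: "0 < d"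
    and card_le: "\<And>r. 0 < r \<Longrightarrow> real (card {i \<in> S. w i \<le> r}) \<le> A * r ^ d"
  shows "finite (B S T)" "real (card (B S T)) \<le> exp (T / R + 8 * A * laplace_const d * R ^ d)"
proof -
  define N where "N = nat \<lceil>T\<rceil>"
  let ?P = "S \<rightarrow>\<^sub>E {- int N..int N}"
  have sub: "B S T \<subseteq> ?P"
  proof
    fix b assume "b \<in> B S T"
    then have b: "b \<in> S \<rightarrow>\<^sub>E UNIV" and T: "(\<Sum>i\<in>S. w i * \<bar>of_int (b i)\<bar>) \<le> T" by (auto simp: B_def)
    have "\<bar>b i\<bar> \<le> int N" if i: "i \<in> S" for i
    proof -
      have "\<bar>of_int (b i)\<bar> \<le> w i * \<bar>of_int (b i)\<bar>"
        using mult_right_mono[OF w[OF i], of "\<bar>of_int (b i)\<bar>"] by simp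
      also have "\<dots> \<le> (\<Sum>i\<in>S. w i * \<bar>of_int (b i)\<bar>)"
      proof (rule member_le_sum[OF i _ S])
        fix j assume "j \<in> S - {i}"
        then show "0 \<le> w j * \<bar>of_int (b j)\<bar>" using w[of j] by simp
      qed
      also note T
      finally have "of_int \<bar>b i\<bar> \<le> T" by simp
      then show ?thesis unfolding N_def by linarith
    qed
    then show "b \<in> ?P" using b by (auto simp: PiE_iff abs_le_iff) (metis minus_le_iff)
  qed
  have finP: "finite ?P" using S by (intro finite_PiE) auto
  show finB: "finite (B S T)" using sub finP by (rule finite_subset)
  define q where "q i = exp (- (w i / R))" for i
  have q: "0 \<le> q i" "q i < 1" if "i \<in> S" for i
    using w[OF that] R by (auto simp: q_def)
  \<comment> \<open>Since weights are at least \<open>1\<close>, \<open>R \<le> 2 ^ J\<close> brings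
    \<open>q i ^ 2 ^ J\<close> below \<open>exp (- 1)\<close>. The size of \<open>J\<close> is
    harmless because the sum over scales is geometric.\<close>
  define J where "J = nat \<lceil>R\<rceil>"
  have qJ: "q i ^ 2 ^ J \<le> 1 / 2" if i: "i \<in> S" for i
  proof -
    have "R \<le> real J" unfolding J_def by linarith
    also have "\<dots> \<le> 2 ^ J" by (metis less_exp less_imp_le of_nat_le_iff of_nat_numeral of_nat_power)
    also have "\<dots> \<le> 2 ^ J * w i" using mult_left_mono[OF w[OF i], of "2 ^ J"] by simp
    finally have "R \<le> 2 ^ J * w i" .
    then have "1 \<le> 2 ^ J * (w i / R)" using R by (simp add: pos_le_divide_eq)
    then have "exp (- (2 ^ J * (w i / R))) \<le> exp (- 1 :: real)" by simp
    also have "\<dots> \<le> 1 / 2"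
      using exp_ge_add_one_self[of "1 :: real"] by (simp add: exp_minus field_simps)
    finally show ?thesis by (simp add: q_def exp_of_nat_mult[symmetric])
  qed
  have "real (card (B S T)) = (\<Sum>b\<in>B S T. 1)" by simp
  also have "\<dots> \<le> (\<Sum>b\<in>B S T. exp (T / R) * (\<Prod>i\<in>S. q i ^ nat \<bar>b i\<bar>))"
  proof (rule sum_mono)
    fix b assume "b \<in> B S T"
    then have T: "(\<Sum>i\<in>S. w i * \<bar>of_int (b i)\<bar>) \<le> T" by (auto simp: B_def)
    have "(\<Prod>i\<in>S. q i ^ nat \<bar>b i\<bar>) = exp (- ((\<Sum>i\<in>S. w i * \<bar>of_int (b i)\<bar>) / R))"
      using S by (simp add: q_def exp_of_nat_mult[symmetric] exp_sum[symmetric] sum_divide_distrib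
          sum_negf[symmetric] mult_ac)
    then have "exp (T / R) * (\<Prod>i\<in>S. q i ^ nat \<bar>b i\<bar>)
        = exp (T / R - (\<Sum>i\<in>S. w i * \<bar>of_int (b i)\<bar>) / R)"
      by (simp add: exp_diff exp_minus divide_inverse)
    also have "\<dots> \<ge> 1" using T R by (simp add: divide_right_mono)
    finally show "1 \<le> exp (T / R) * (\<Prod>i\<in>S. q i ^ nat \<bar>b i\<bar>)" .
  qed
  also have "\<dots> \<le> (\<Sum>b\<in>?P. exp (T / R) * (\<Prod>i\<in>S. q i ^ nat \<bar>b i\<bar>))"
    using q by (intro sum_mono2[OF finP sub] mult_nonneg_nonneg prod_nonneg) auto
  also have "\<dots> = exp (T / R) * (\<Prod>i\<in>S. \<Sum>k\<in>{- int N..int N}. q i ^ nat \<bar>k\<bar>)"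
    using S by (subst prod_sum_PiE) (auto simp: sum_distrib_left)
  also have "\<dots> \<le> exp (T / R) * (\<Prod>i\<in>S. exp (4 * (\<Sum>j\<le>J. q i ^ 2 ^ j)))"
  proof (intro mult_left_mono prod_mono conjI)
    fix i assume i: "i \<in> S"
    show "0 \<le> (\<Sum>k\<in>{- int N..int N}. q i ^ nat \<bar>k\<bar>)" using q[OF i] by (intro sum_nonneg) auto
    have "(\<Sum>k\<in>{- int N..int N}. q i ^ nat \<bar>k\<bar>) \<le> (1 + q i) / (1 - q i)"
      by (rule sum_power_abs_le[OF q[OF i]])
    also have "\<dots> \<le> exp (4 * (\<Sum>j\<le>J. q i ^ 2 ^ j))"
      by (rule ratio_le_exp_sum_powers[OF q[OF i] qJ[OF i]])
    finally show "(\<Sum>k\<in>{- int N..int N}. q i ^ nat \<bar>k\<bar>) \<le> exp (4 * (\<Sum>j\<le>J. q i ^ 2 ^ j))" .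
  qed simp
  also have "\<dots> = exp (T / R + 4 * (\<Sum>j\<le>J. \<Sum>i\<in>S. exp (- (2 ^ j / R) * w i)))"
  proof -
    have "(\<Prod>i\<in>S. exp (4 * (\<Sum>j\<le>J. q i ^ 2 ^ j))) = exp (4 * (\<Sum>i\<in>S. \<Sum>j\<le>J. q i ^ 2 ^ j))"
      using S by (simp add: exp_sum[symmetric] sum_distrib_left)
    also have "(\<Sum>i\<in>S. \<Sum>j\<le>J. q i ^ 2 ^ j) = (\<Sum>j\<le>J. \<Sum>i\<in>S. exp (- (2 ^ j / R) * w i))"
      by (subst sum.swap) (simp add: q_def exp_of_nat_mult[symmetric])
    finally show ?thesis by (simp add: exp_add)
  qed
  also have "\<dots> \<le> exp (T / R + 4 * (\<Sum>j\<le>J. A * laplace_const d * R ^ d * (1 / 2) ^ j))"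
  proof -
    have "(\<Sum>i\<in>S. exp (- (2 ^ j / R) * w i)) \<le> A * laplace_const d * R ^ d * (1 / 2) ^ j" for j
    proof -
      have "(\<Sum>i\<in>S. exp (- (2 ^ j / R) * w i)) \<le> A * laplace_const d / (2 ^ j / R) ^ d"
      proof (rule sum_exp_weight_le[OF S _ _ \<open>0 \<le> A\<close> card_le])
        show "0 < w i" if "i \<in> S" for i using w[OF that] by simp
        show "0 < 2 ^ j / R" using R by simp
      qed
      also have "\<dots> = (A * laplace_const d * R ^ d) * (1 / (2 ^ j) ^ d)"
        using R by (simp add: power_divide)
      also have "\<dots> \<le> (A * laplace_const d * R ^ d) * (1 / 2 ^ j)"
      proof (intro mult_left_mono)
        have "(2 ^ j) ^ 1 \<le> (2 ^ j :: real) ^ d" using d by (intro power_increasing) auto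
        then show "1 / (2 ^ j :: real) ^ d \<le> 1 / 2 ^ j" by (intro divide_left_mono) auto
      qed (use \<open>0 \<le> A\<close> laplace_const_pos[of d] R in auto)
      finally show ?thesis by (simp add: power_divide)
    qed
    then show ?thesis by (simp add: sum_mono)
  qed
  also have "\<dots> \<le> exp (T / R + 4 * (A * laplace_const d * R ^ d * 2))"
  proof -
    have "(\<Sum>j\<le>J. (1 / 2) ^ j) = (2 :: real) - (1 / 2) ^ J" by (induction J) auto
    then have "(\<Sum>j\<le>J. (1 / 2) ^ j) \<le> (2 :: real)" by simp
    then have "A * laplace_const d * R ^ d * (\<Sum>j\<le>J. (1 / 2) ^ j) \<le> A * laplace_const d * R ^ d * 2"
      using \<open>0 \<le> A\<close> laplace_const_pos[of d] R by (intro mult_left_mono) auto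
    then show ?thesis unfolding sum_distrib_left[symmetric] by simp
  qed
  finally show "real (card (B S T)) \<le> exp (T / R + 8 * A * laplace_const d * R ^ d)"
    by (simp add: mult_ac)
qed

section \<open>Entropy of general Barron functions\<close>

lemma sum_atom_Lipschitz:
  fixes x y :: "real ^ 'n::finite"
  assumes x: "x \<in> cbox 0 1" and y: "y \<in> cbox 0 1"
    and a: "(\<Sum>(q, k, l)\<in>S. atom_weight k l * \<bar>a (q, k, l)\<bar>) \<le> A"
  shows "\<bar>(\<Sum>(q, k, l)\<in>S. a (q, k, l) * atom q k l x) - (\<Sum>(q, k, l)\<in>S. a (q, k, l) * atom q k l y)\<bar>
    \<le> 2 * pi * A * (\<Sum>j\<in>UNIV. \<bar>x $ j - y $ j\<bar>)"
proof -
  define D where "D = (\<Sum>j\<in>UNIV. \<bar>x $ j - y $ j\<bar>)"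
  have D: "0 \<le> D" by (simp add: D_def sum_nonneg)
  have "(\<Sum>(q, k, l)\<in>S. a (q, k, l) * atom q k l x) - (\<Sum>(q, k, l)\<in>S. a (q, k, l) * atom q k l y)
      = (\<Sum>(q, k, l)\<in>S. a (q, k, l) * (atom q k l x - atom q k l y))"
    by (simp add: sum_subtractf[symmetric] split_def right_diff_distrib)
  also have "\<bar>\<dots>\<bar> \<le> (\<Sum>(q, k, l)\<in>S. \<bar>a (q, k, l)\<bar> * (2 * pi * atom_weight k l * D))"
    by (rule order_trans[OF sum_abs])
      (auto intro!: sum_mono mult_left_mono atom_Lipschitz[OF x y, folded D_def] simp: abs_mult split_def)
  also have "\<dots> = 2 * pi * D * (\<Sum>(q, k, l)\<in>S. atom_weight k l * \<bar>a (q, k, l)\<bar>)"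
    unfolding sum_distrib_left by (intro sum.cong) (auto simp: mult_ac)
  also have "\<dots> \<le> 2 * pi * D * A"
    using a by (intro mult_left_mono) (use D in auto)
  finally show ?thesis by (simp add: D_def[symmetric] mult_ac)
qed

lemma sum_abs_component_le: "(\<Sum>j\<in>UNIV. \<bar>x $ j\<bar>) \<le> real CARD('n) * norm x"
  for x :: "real ^ 'n::finite"
  using sum_bounded_above[of UNIV "\<lambda>j. \<bar>x $ j\<bar>" "norm x"] component_le_norm_cart[of x] by simp

text \<open>All approximants share one Lipschitz constant, which survives the limit. Continuity
  supplies the measurability without which \<open>Linf_dist\<close> would be infinite.\<close>

lemma general_barron_continuous_on:
  fixes f :: "real ^ 'n::finite \<Rightarrow> real"
  assumes C: "0 < C" and f: "f \<in> general_barron C"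
  shows "continuous_on (cbox 0 1) f"
proof -
  define A where "A = C * (1 + 16 * pi * (real CARD('n))\<^sup>2 * exp (2 * pi * (real CARD('n))\<^sup>2))"
  have A: "0 \<le> A" using C by (simp add: A_def)
  define L where "L = 2 * pi * A * real CARD('n)"
  have "dist (f x) (f y) \<le> L * dist x y" if x: "x \<in> cbox 0 1" and y: "y \<in> cbox 0 1" for x y
  proof (rule field_le_epsilon)
    fix e :: real assume "0 < e"
    obtain K M where "\<forall>f \<in> (general_barron C :: (real ^ 'n \<Rightarrow> real) set).
      \<exists>a. (\<Sum>(q, k, l)\<in>atom_indices K M. atom_weight k l * \<bar>a (q, k, l)\<bar>) \<le> A \<and>
        (\<forall>x\<in>cbox 0 1. \<bar>f x - (\<Sum>(q, k, l)\<in>atom_indices K M. a (q, k, l) * atom q k l x)\<bar> \<le> e / 2)"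
      using general_barron_approx[OF C, of "e / 2", where 'n = 'n] \<open>0 < e\<close> unfolding A_def by fastforce
    with f obtain a where a: "(\<Sum>(q, k, l)\<in>atom_indices K M. atom_weight k l * \<bar>a (q, k, l)\<bar>) \<le> A"
      "\<And>x. x \<in> cbox 0 1 \<Longrightarrow> \<bar>f x - (\<Sum>(q, k, l)\<in>atom_indices K M. a (q, k, l) * atom q k l x)\<bar> \<le> e / 2"
      by blast
    have "2 * pi * A * (\<Sum>j\<in>UNIV. \<bar>(x - y) $ j\<bar>) \<le> 2 * pi * A * (real CARD('n) * norm (x - y))"
      using A by (intro mult_left_mono sum_abs_component_le) auto
    then have "\<bar>f x - f y\<bar> \<le> 2 * pi * A * (real CARD('n) * norm (x - y)) + e"
      using sum_atom_Lipschitz[OF x y a(1)] a(2)[OF x] a(2)[OF y]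
      unfolding vector_minus_component by linarith
    then show "dist (f x) (f y) \<le> L * dist x y + e"
      by (simp add: dist_real_def dist_norm L_def mult_ac)
  qed
  then have "L-lipschitz_on (cbox 0 1) f"
    using A by (intro lipschitz_onI) (auto simp: L_def)
  then show ?thesis by (rule lipschitz_on_continuous_on)
qed

lemma Linf_dist_le:
  fixes f g :: "real ^ 'n::finite \<Rightarrow> real"
  assumes f: "continuous_on (cbox 0 1) f" and g: "continuous_on (cbox 0 1) g"
    and le: "\<And>x. x \<in> cbox 0 1 \<Longrightarrow> \<bar>f x - g x\<bar> \<le> e"
  shows "Linf_dist f g \<le> ereal e"
  unfolding Linf_dist_def
proof (rule esssup_I)
  have "(\<lambda>x. \<bar>f x - g x\<bar>) \<in> borel_measurable (lebesgue_on (cbox 0 1))"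
    using f g by (intro continuous_imp_measurable_on_sets_lebesgue continuous_intros) auto
  then show "(\<lambda>x. ereal \<bar>f x - g x\<bar>) \<in> borel_measurable (lebesgue_on (cbox 0 1))"
    by (rule borel_measurable_ereal)
  show "AE x in lebesgue_on (cbox 0 1). ereal \<bar>f x - g x\<bar> \<le> ereal e"
    by (rule AE_I2) (use le in auto)
qed

lemma cube_net:
  assumes n: "0 < n"
  obtains G :: "(real ^ 'n::finite) set" where "finite G" "G \<noteq> {}" "G \<subseteq> cbox 0 1"
    "card G \<le> (n + 1) ^ CARD('n)"
    "\<And>x. x \<in> cbox 0 1 \<Longrightarrow> \<exists>g\<in>G. (\<Sum>j\<in>UNIV. \<bar>x $ j - g $ j\<bar>) \<le> real CARD('n) / real n"
proof -
  let ?P = "(UNIV :: 'n set) \<rightarrow>\<^sub>E {0..n}"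
  define v where "v f = (\<chi> j. real (f j) / real n)" for f :: "'n \<Rightarrow> nat"
  have fin: "finite ?P" by (intro finite_PiE) auto
  show ?thesis
  proof (rule that[of "v ` ?P"])
    show "finite (v ` ?P)" using fin by simp
    have "(\<lambda>_. 0) \<in> ?P" by auto
    then show "v ` ?P \<noteq> {}" by blast
    show "v ` ?P \<subseteq> cbox 0 1" using n by (auto simp: v_def mem_box_cart PiE_iff)
    have "card (v ` ?P) \<le> card ?P" by (rule card_image_le[OF fin])
    also have "\<dots> = (n + 1) ^ CARD('n)" by (subst card_PiE) auto
    finally show "card (v ` ?P) \<le> (n + 1) ^ CARD('n)" .
    fix x :: "real ^ 'n" assume x: "x \<in> cbox 0 1"
    define f where "f j = nat \<lfloor>real n * x $ j\<rfloor>" for j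
    have x01: "0 \<le> x $ j" "x $ j \<le> 1" for j using x by (auto simp: mem_box_cart)
    have f: "real (f j) \<le> real n * x $ j" "real n * x $ j \<le> real (f j) + 1" for j
    proof -
      have "0 \<le> real n * x $ j" using x01(1)[of j] by simp
      then show "real (f j) \<le> real n * x $ j" "real n * x $ j \<le> real (f j) + 1"
        unfolding f_def by linarith+
    qed
    have "real (f j) \<le> real n" for j
      using f(1)[of j] mult_left_mono[OF x01(2)[of j], of "real n"] by simp
    then have "f \<in> ?P" by auto
    moreover have "(\<Sum>j\<in>UNIV. \<bar>x $ j - v f $ j\<bar>) \<le> real CARD('n) / real n"
    proof -
      have "\<bar>x $ j - v f $ j\<bar> \<le> 1 / real n" for j
      proof -
        have "\<bar>real n * x $ j - real (f j)\<bar> \<le> 1" using f[of j] by linarith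
        then have "\<bar>real n * x $ j - real (f j)\<bar> / real n \<le> 1 / real n" by (intro divide_right_mono) auto
        moreover have "x $ j - v f $ j = (real n * x $ j - real (f j)) / real n"
          using n by (simp add: v_def field_simps)
        ultimately show ?thesis by (simp only: abs_divide abs_of_nat)
      qed
      then show ?thesis using sum_bounded_above[of UNIV "\<lambda>j. \<bar>x $ j - v f $ j\<bar>" "1 / real n"] by simp
    qed
    ultimately show "\<exists>g\<in>v ` ?P. (\<Sum>j\<in>UNIV. \<bar>x $ j - g $ j\<bar>) \<le> real CARD('n) / real n" by blast
  qed
qed

section \<open>Variance, separated families and the packing number\<close>

lemma sum_min_le:
  fixes a w :: "'i \<Rightarrow> real"
  assumes S: "finite S" and R: "0 < R" and \<delta>: "0 \<le> \<delta>" and w: "\<And>i. i \<in> S \<Longrightarrow> 0 \<le> w i"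
    and A: "(\<Sum>i\<in>S. w i * \<bar>a i\<bar>) \<le> A"
  shows "(\<Sum>i\<in>S. min (\<delta>\<^sup>2) (\<delta> * \<bar>a i\<bar>)) \<le> real (card {i \<in> S. w i \<le> R}) * \<delta>\<^sup>2 + \<delta> * A / R"
proof -
  have "min (\<delta>\<^sup>2) (\<delta> * \<bar>a i\<bar>) \<le> (if w i \<le> R then \<delta>\<^sup>2 else 0) + \<delta> / R * (w i * \<bar>a i\<bar>)" if "i \<in> S" for i
  proof (cases "w i \<le> R")
    case True
    then show ?thesis using w[OF that] R \<delta> by (simp add: min.coboundedI1)
  next
    case False
    then have "1 \<le> w i / R" using R by (simp add: pos_le_divide_eq)
    then have "\<delta> * \<bar>a i\<bar> * 1 \<le> \<delta> * \<bar>a i\<bar> * (w i / R)" using \<delta> by (intro mult_left_mono) auto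
    then show ?thesis using False by (simp add: mult_ac min.coboundedI2)
  qed
  then have "(\<Sum>i\<in>S. min (\<delta>\<^sup>2) (\<delta> * \<bar>a i\<bar>))
      \<le> (\<Sum>i\<in>S. (if w i \<le> R then \<delta>\<^sup>2 else 0) + \<delta> / R * (w i * \<bar>a i\<bar>))" by (rule sum_mono)
  also have "\<dots> = real (card {i \<in> S. w i \<le> R}) * \<delta>\<^sup>2 + \<delta> / R * (\<Sum>i\<in>S. w i * \<bar>a i\<bar>)"
    using S by (simp add: sum.distrib sum.If_cases Int_def sum_distrib_left)
  also have "\<dots> \<le> real (card {i \<in> S. w i \<le> R}) * \<delta>\<^sup>2 + \<delta> / R * A"
    using A R \<delta> by (intro add_left_mono mult_left_mono) auto
  finally show ?thesis by simp
qed

text \<open>The error budget is \<open>\<epsilon> / 8\<close> for the expansion,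
  \<open>\<epsilon> / 8\<close> for rounding at a grid point and \<open>\<epsilon> / 4\<close> for
  leaving the grid. Functions sharing a rounded vector are thus within \<open>\<epsilon>\<close>, so
  a separated family injects into the set of vectors.\<close>

lemma card_separated_le:
  fixes C \<epsilon> R lam :: real and N :: "(real ^ 'n::finite \<Rightarrow> real) set"
  defines "d \<equiv> CARD('n)"
  defines "A \<equiv> C * (1 + 16 * pi * (real d)\<^sup>2 * exp (2 * pi * (real d)\<^sup>2))" and "B \<equiv> 4 * 2 ^ d :: real"
  assumes C: "0 < C" and \<epsilon>: "0 < \<epsilon>" and R: "0 < R" and n: "0 < n" and lam: "0 < lam"
    and mesh: "6 * pi * A * (real d / real n) \<le> \<epsilon> / 4"
    and lam_le: "lam \<le> R ^ (d + 1)"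
    and err: "ln (4 * (real n + 1) ^ d) / lam + 2 * lam * ((B + A) / R ^ (d + 2)) \<le> \<epsilon> / 8"
    and N: "finite N" "N \<subseteq> general_barron C"
    and sep: "\<And>f g. f \<in> N \<Longrightarrow> g \<in> N \<Longrightarrow> f \<noteq> g \<Longrightarrow> ereal \<epsilon> < Linf_dist f g"
  shows "real (card N) \<le> exp ((2 * A + 8 * B * laplace_const d) * R ^ d)"
proof -
  have A: "0 < A" unfolding A_def using C by (intro mult_pos_pos add_pos_nonneg) auto
  have d: "0 < d" by (simp add: d_def)
  \<comment> \<open>This step balances the variance terms
    \<open>B * R ^ d * \<delta>\<^sup>2\<close> and \<open>\<delta> * A / R\<close>, both of order
    \<open>1 / R ^ (d + 2)\<close>; it also makes the term \<open>T / R\<close> of the vector count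
    equal to \<open>2 * A * R ^ d\<close>.\<close>
  define \<delta> where "\<delta> = 1 / R ^ (d + 1)"
  have \<delta>: "0 < \<delta>" "lam * \<delta> \<le> 1" using R lam_le by (auto simp: \<delta>_def)
  obtain K M where KM: "\<forall>f \<in> (general_barron C :: (real ^ 'n \<Rightarrow> real) set).
    \<exists>a. (\<Sum>(q, k, l)\<in>atom_indices K M. atom_weight k l * \<bar>a (q, k, l)\<bar>) \<le> A \<and>
      (\<forall>x\<in>cbox 0 1. \<bar>f x - (\<Sum>(q, k, l)\<in>atom_indices K M. a (q, k, l) * atom q k l x)\<bar> \<le> \<epsilon> / 8)"
    using general_barron_approx[OF C, of "\<epsilon> / 8", where 'n = 'n] \<epsilon> unfolding A_def d_def by fastforce
  define S :: "(nat \<times> (int ^ 'n) \<times> 'n list) set" where "S = atom_indices K M"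
  define w where "w = (\<lambda>(q :: nat, k :: int ^ 'n, l :: 'n list). atom_weight k l)"
  define c where "c x = (\<lambda>(q, k, l). atom q k l x)" for x :: "real ^ 'n"
  have S: "finite S" unfolding S_def by (rule finite_atom_indices)
  have w1: "1 \<le> w i" for i by (cases i) (simp add: w_def atom_weight_ge_1)
  have w0: "0 \<le> w i" for i using w1[of i] by simp
  have w_sum: "(\<Sum>(q, k, l)\<in>S. atom_weight k l * \<bar>a (q, k, l)\<bar>) = (\<Sum>i\<in>S. w i * \<bar>a i\<bar>)" for a
    by (intro sum.cong) (auto simp: w_def)
  have c_sum: "(\<Sum>(q, k, l)\<in>S. a (q, k, l) * atom q k l x) = (\<Sum>i\<in>S. a i * c x i)" for a x
    by (intro sum.cong) (auto simp: c_def)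
  have card_le: "real (card {i \<in> S. w i \<le> r}) \<le> B * r ^ d" if "0 < r" for r
  proof -
    have "{i \<in> S. w i \<le> r} = {(q, k, l) \<in> S. atom_weight k l \<le> r}" by (auto simp: w_def)
    then show ?thesis using card_atom_weight_le[OF that, of K M, where 'n = 'n] by (simp add: S_def B_def d_def)
  qed
  obtain G :: "(real ^ 'n) set" where G: "finite G" "G \<noteq> {}" "G \<subseteq> cbox 0 1"
    "card G \<le> (n + 1) ^ d"
    "\<And>x. x \<in> cbox 0 1 \<Longrightarrow> \<exists>g\<in>G. (\<Sum>j\<in>UNIV. \<bar>x $ j - g $ j\<bar>) \<le> real d / real n"
    using cube_net[OF n, where 'n = 'n] unfolding d_def by blast
  define T where "T = 2 * A / \<delta>"
  define Q where "Q = {b \<in> S \<rightarrow>\<^sub>E (UNIV :: int set). (\<Sum>i\<in>S. w i * \<bar>of_int (b i)\<bar>) \<le> T}"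
  have Q: "finite Q" "real (card Q) \<le> exp (T / R + 8 * B * laplace_const d * R ^ d)"
    unfolding Q_def
    by (rule card_weighted_integer_vectors[OF S w1 R _ d card_le]; simp add: B_def)+
  have approx: "\<exists>b\<in>Q. \<forall>x\<in>cbox 0 1. \<bar>f x - (\<Sum>i\<in>S. \<delta> * of_int (b i) * c x i)\<bar> \<le> \<epsilon> / 2"
    if f: "f \<in> general_barron C" for f :: "real ^ 'n \<Rightarrow> real"
  proof -
    obtain a where a: "(\<Sum>i\<in>S. w i * \<bar>a i\<bar>) \<le> A"
      and fa: "\<And>x. x \<in> cbox 0 1 \<Longrightarrow> \<bar>f x - (\<Sum>i\<in>S. a i * c x i)\<bar> \<le> \<epsilon> / 8"
      using KM f unfolding S_def[symmetric] w_sum c_sum by blast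
    have V: "(\<Sum>i\<in>S. min (\<delta>\<^sup>2) (\<delta> * \<bar>a i\<bar>)) \<le> (B + A) / R ^ (d + 2)"
    proof -
      have "(\<Sum>i\<in>S. min (\<delta>\<^sup>2) (\<delta> * \<bar>a i\<bar>)) \<le> real (card {i \<in> S. w i \<le> R}) * \<delta>\<^sup>2 + \<delta> * A / R"
        by (rule sum_min_le[OF S R less_imp_le[OF \<delta>(1)] w0 a])
      also have "\<dots> \<le> (B * R ^ d) * \<delta>\<^sup>2 + \<delta> * A / R"
        by (intro add_right_mono mult_right_mono card_le R) auto
      also have "\<dots> = (B + A) / R ^ (d + 2)"
        using R by (simp add: \<delta>_def field_simps power2_eq_square)
      finally show ?thesis .
    qed
    have "\<exists>b :: _ \<Rightarrow> int. (\<Sum>i\<in>S. w i * \<bar>of_int (b i)\<bar>) \<le> 2 * A / \<delta> \<and>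
      (\<forall>x\<in>G. \<bar>\<Sum>i\<in>S. (a i - \<delta> * of_int (b i)) * c x i\<bar>
        \<le> ln (4 * real (card G)) / lam + 2 * lam * ((B + A) / R ^ (d + 2)))"
    proof (rule integer_rounding[OF S G(1,2) \<delta>(1) lam \<delta>(2) _ w0 A a V])
      show "\<bar>c x i\<bar> \<le> 1" if "x \<in> G" for x i
        using G(3) that abs_atom_le_1[of x] by (cases i) (auto simp: c_def)
    qed
    then obtain b :: "_ \<Rightarrow> int" where b: "(\<Sum>i\<in>S. w i * \<bar>of_int (b i)\<bar>) \<le> 2 * A / \<delta>"
      and bG: "\<And>x. x \<in> G \<Longrightarrow> \<bar>\<Sum>i\<in>S. (a i - \<delta> * of_int (b i)) * c x i\<bar>
        \<le> ln (4 * real (card G)) / lam + 2 * lam * ((B + A) / R ^ (d + 2))"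
      by blast
    have ln_le: "ln (4 * real (card G)) / lam \<le> ln (4 * (real n + 1) ^ d) / lam"
    proof (rule divide_right_mono)
      have "real (card G) \<le> real ((n + 1) ^ d)" using G(4) by (rule of_nat_mono)
      also have "\<dots> = (real n + 1) ^ d" by (simp add: add.commute)
      finally have "4 * real (card G) \<le> 4 * (real n + 1) ^ d" by simp
      moreover have "0 < real (card G)" using G(1,2) by (simp add: card_gt_0_iff)
      ultimately show "ln (4 * real (card G)) \<le> ln (4 * (real n + 1) ^ d)" by simp
    qed (use lam in simp)
    \<comment> \<open>The weighted norm of the rounding error is at most
      \<open>A + \<delta> * (2 * A / \<delta>) = 3 * A\<close>. This is the source of the Lipschitz
      constant \<open>6 * pi * A\<close> in the mesh condition.\<close>
    define u where "u i = a i - \<delta> * of_int (b i)" for i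
    have "(\<Sum>i\<in>S. w i * \<bar>u i\<bar>) \<le> (\<Sum>i\<in>S. w i * \<bar>a i\<bar> + \<delta> * (w i * \<bar>of_int (b i)\<bar>))"
    proof (rule sum_mono)
      fix i
      have "\<bar>u i\<bar> \<le> \<bar>a i\<bar> + \<delta> * \<bar>of_int (b i)\<bar>"
        unfolding u_def using abs_triangle_ineq4[of "a i" "\<delta> * of_int (b i)"] \<delta> by (simp add: abs_mult)
      then have "w i * \<bar>u i\<bar> \<le> w i * (\<bar>a i\<bar> + \<delta> * \<bar>of_int (b i)\<bar>)" using w0 by (rule mult_left_mono)
      then show "w i * \<bar>u i\<bar> \<le> w i * \<bar>a i\<bar> + \<delta> * (w i * \<bar>of_int (b i)\<bar>)" by (simp add: algebra_simps)
    qed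
    also have "\<dots> = (\<Sum>i\<in>S. w i * \<bar>a i\<bar>) + \<delta> * (\<Sum>i\<in>S. w i * \<bar>of_int (b i)\<bar>)"
      by (simp add: sum.distrib sum_distrib_left)
    also have "\<dots> \<le> A + \<delta> * (2 * A / \<delta>)" using a b \<delta> by (intro add_mono mult_left_mono) auto
    finally have u: "(\<Sum>i\<in>S. w i * \<bar>u i\<bar>) \<le> 3 * A" using \<delta> by simp
    have "\<bar>f x - (\<Sum>i\<in>S. \<delta> * of_int (b i) * c x i)\<bar> \<le> \<epsilon> / 2" if x: "x \<in> cbox 0 1" for x
    proof -
      obtain g where g: "g \<in> G" "(\<Sum>j\<in>UNIV. \<bar>x $ j - g $ j\<bar>) \<le> real d / real n" using G(5)[OF x] by blast
      have "\<bar>(\<Sum>i\<in>S. u i * c x i) - (\<Sum>i\<in>S. u i * c g i)\<bar> \<le> 2 * pi * (3 * A) * (\<Sum>j\<in>UNIV. \<bar>x $ j - g $ j\<bar>)"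
        using sum_atom_Lipschitz[OF x, where y = g and S = S and a = u and A = "3 * A"] u g(1) G(3) unfolding w_sum c_sum by blast
      also have "\<dots> \<le> 2 * pi * (3 * A) * (real d / real n)" using g(2) A by (intro mult_left_mono) auto
      finally have "\<bar>(\<Sum>i\<in>S. u i * c x i) - (\<Sum>i\<in>S. u i * c g i)\<bar> \<le> \<epsilon> / 4" using mesh by simp
      moreover have "\<bar>\<Sum>i\<in>S. u i * c g i\<bar> \<le> \<epsilon> / 8"
        using bG[OF g(1)] ln_le err unfolding u_def by linarith
      moreover have "(\<Sum>i\<in>S. \<delta> * of_int (b i) * c x i) = (\<Sum>i\<in>S. a i * c x i) - (\<Sum>i\<in>S. u i * c x i)"
        by (simp add: u_def left_diff_distrib sum_subtractf)
      ultimately show ?thesis using fa[OF x] by linarith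
    qed
    moreover have "(\<Sum>i\<in>S. w i * \<bar>of_int (restrict b S i)\<bar>) = (\<Sum>i\<in>S. w i * \<bar>of_int (b i)\<bar>)"
      "(\<Sum>i\<in>S. \<delta> * of_int (restrict b S i) * c x i) = (\<Sum>i\<in>S. \<delta> * of_int (b i) * c x i)" for x
      by (auto intro!: sum.cong)
    moreover have "restrict b S \<in> S \<rightarrow>\<^sub>E UNIV" by auto
    ultimately show ?thesis using b unfolding Q_def T_def by (intro bexI[of _ "restrict b S"]) auto
  qed
  define P where "P f b \<longleftrightarrow> b \<in> Q \<and> (\<forall>x\<in>cbox 0 1. \<bar>f x - (\<Sum>i\<in>S. \<delta> * of_int (b i) * c x i)\<bar> \<le> \<epsilon> / 2)"
    for f :: "real ^ 'n \<Rightarrow> real" and b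
  have "\<exists>b. P f b" if "f \<in> general_barron C" for f
    using approx[OF that] unfolding P_def by blast
  then obtain \<beta> where P: "\<And>f. f \<in> general_barron C \<Longrightarrow> P f (\<beta> f)" by metis
  have \<beta>: "\<And>f. f \<in> general_barron C \<Longrightarrow> \<beta> f \<in> Q"
    "\<And>f x. f \<in> general_barron C \<Longrightarrow> x \<in> cbox 0 1 \<Longrightarrow> \<bar>f x - (\<Sum>i\<in>S. \<delta> * of_int (\<beta> f i) * c x i)\<bar> \<le> \<epsilon> / 2"
    using P unfolding P_def by blast+
  have "inj_on \<beta> N"
  proof (rule inj_onI, rule ccontr)
    fix f g assume fg: "f \<in> N" "g \<in> N" "\<beta> f = \<beta> g" "f \<noteq> g"
    then have GB: "f \<in> general_barron C" "g \<in> general_barron C" using N(2) by auto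
    have "\<bar>f x - g x\<bar> \<le> \<epsilon>" if "x \<in> cbox 0 1" for x
      using \<beta>(2)[OF GB(1) that] \<beta>(2)[OF GB(2) that] unfolding fg(3) by linarith
    then have "Linf_dist f g \<le> ereal \<epsilon>"
      using GB by (intro Linf_dist_le general_barron_continuous_on[OF C]) auto
    then show False using sep[OF fg(1,2,4)] by simp
  qed
  then have "card N \<le> card Q" using \<beta>(1) N Q(1) by (intro card_inj_on_le[of \<beta>]) auto
  then have "real (card N) \<le> exp (T / R + 8 * B * laplace_const d * R ^ d)" using Q(2) by linarith
  also have "T / R + 8 * B * laplace_const d * R ^ d = (2 * A + 8 * B * laplace_const d) * R ^ d"
    using R by (simp add: T_def \<delta>_def field_simps)
  finally show ?thesis .
qed

text \<open>A bound on finite packing sets also excludes infinite ones, which would contain finite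
  packing sets of every size.\<close>

lemma packing_entropy_le:
  assumes X: "0 \<le> X"
    and card_le: "\<And>N. finite N \<Longrightarrow> packing_set K D \<epsilon> N \<Longrightarrow> real (card N) \<le> exp X"
  shows "packing_entropy K D \<epsilon> \<le> ereal X"
proof -
  define m where "m = nat \<lfloor>exp X\<rfloor>"
  have m: "real m \<le> exp X" unfolding m_def by simp
  have le: "card N \<le> m" if "finite N" "packing_set K D \<epsilon> N" for N
    using card_le[OF that] unfolding m_def by (simp add: le_nat_floor)
  have "(if finite N then enat (card N) else \<infinity>) \<le> enat m" if N: "packing_set K D \<epsilon> N" for N
  proof (cases "finite N")
    case False
    then obtain F where F: "finite F" "card F = Suc m" "F \<subseteq> N"
      using infinite_arbitrarily_large by blast
    then have "packing_set K D \<epsilon> F" using N by (auto simp: packing_set_def)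
    then show ?thesis using le[OF F(1)] F(2) by simp
  qed (use le N in simp)
  then have "packing_number K D \<epsilon> \<le> enat m"
    unfolding packing_number_def by (intro SUP_least) auto
  then obtain k where k: "packing_number K D \<epsilon> = enat k" "k \<le> m"
    by (cases "packing_number K D \<epsilon>") auto
  have "ln (real k) \<le> X"
  \<comment> \<open>For \<open>k = 0\<close> the convention \<open>ln 0 = 0\<close> leaves
    \<open>0 \<le> X\<close>.\<close>
  proof (cases "k = 0")
    case False
    then have "ln (real k) \<le> ln (exp X)" using k(2) m by (subst ln_le_cancel_iff) auto
    then show ?thesis by simp
  qed (use X in simp)
  then show ?thesis by (simp add: packing_entropy_def k(1))
qed

theorem proposition4p4:
  fixes C :: real
  assumes "C > 0"
  shows "\<exists>C0 > 0. \<forall>\<epsilon> \<in> {0<..<1}.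
    packing_entropy (general_barron C :: (real ^ 'n::finite \<Rightarrow> real) set) Linf_dist \<epsilon>
      \<le> ereal (C0 * \<epsilon> powr (- 1 / (1 / 2 + 1 / real CARD('n))) * (1 + ln (1 / \<epsilon>)))"
proof -
  define d where "d = CARD('n)"
  define A where "A = C * (1 + 16 * pi * (real d)\<^sup>2 * exp (2 * pi * (real d)\<^sup>2))"
  define B where "B = (4 * 2 ^ d :: real)"
  have d1: "1 \<le> real d" unfolding d_def by (rule real_card_ge_1)
  have d0: "0 < d" using d1 by simp
  have A: "0 < A" unfolding A_def using assms by (intro mult_pos_pos add_pos_nonneg) auto
  have B: "0 < B" by (simp add: B_def)
  \<comment> \<open>Gives \<open>real n + 1 \<le> M / \<epsilon>\<close> for the grid parameter
    \<open>n\<close> below; \<open>24\<close> comes from solving the mesh condition for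
    \<open>n\<close>.\<close>
  define M where "M = 24 * pi * A * real d + 2"
  have M: "1 \<le> M" using A by (simp add: M_def)
  \<comment> \<open>Designed so that \<open>ln (4 * (M / \<epsilon>) ^ d) \<le> H * L\<close> with
    \<open>L = 1 + ln (1 / \<epsilon>)\<close>.\<close>
  define H where "H = ln 4 + real d * ln M + real d"
  have H: "1 \<le> H"
  proof -
    have "0 \<le> real d * ln M" using M by simp
    then show ?thesis unfolding H_def using d1 ln_ge_zero[of "4 :: real"] by linarith
  qed
  \<comment> \<open>The three summands ensure that powers of \<open>Q\<close> dominate
    \<open>Q\<close>, that \<open>lam \<le> R ^ (d + 1)\<close>, and that the variance term stays
    below \<open>\<epsilon> / 16\<close>.\<close>
  define Q where "Q = 1 + 16 * H + 512 * H * (B + A)"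
  have Q: "1 \<le> Q" "16 * H \<le> Q" "512 * H * (B + A) \<le> Q" using H A B by (auto simp: Q_def)
  define C0 where "C0 = (2 * A + 8 * B * laplace_const d) * Q ^ d"
  have C0: "0 < C0"
    unfolding C0_def using A B Q laplace_const_pos[of d]
    by (intro mult_pos_pos add_pos_pos zero_less_power) auto
  have "packing_entropy (general_barron C :: (real ^ 'n \<Rightarrow> real) set) Linf_dist \<epsilon>
      \<le> ereal (C0 * \<epsilon> powr (- 1 / (1 / 2 + 1 / real d)) * (1 + ln (1 / \<epsilon>)))"
    if "\<epsilon> \<in> {0<..<1}" for \<epsilon>
  proof -
    have \<epsilon>: "0 < \<epsilon>" "\<epsilon> < 1" using that by auto
    define L where "L = 1 + ln (1 / \<epsilon>)"
    have L: "1 \<le> L" using \<epsilon> by (simp add: L_def ln_div)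
    \<comment> \<open>The power of \<open>\<epsilon>\<close> makes \<open>R ^ (d + 2)\<close> of
      order \<open>1 / \<epsilon>\<^sup>2\<close> up to logarithms. The exponent
      \<open>1 / d\<close> puts exactly one factor \<open>L\<close> into \<open>R ^ d\<close>, and
      then at least one into \<open>R ^ (d + 2)\<close>, which pays for the logarithm of the grid
      size.\<close>
    define R where "R = Q * \<epsilon> powr (- 2 / (real d + 2)) * L powr (1 / real d)"
    have R: "0 < R" using Q \<epsilon> L by (simp add: R_def)
    have pow: "R ^ m = Q ^ m * \<epsilon> powr (- 2 * real m / (real d + 2)) * L powr (real m / real d)" for m
    proof -
      have "(\<epsilon> powr (- 2 / (real d + 2))) ^ m = \<epsilon> powr (- 2 * real m / (real d + 2))"
        using \<epsilon> by (simp add: powr_power mult.commute)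
      moreover have "(L powr (1 / real d)) ^ m = L powr (real m / real d)"
        using L by (simp add: powr_power mult.commute)
      ultimately show ?thesis by (simp add: R_def power_mult_distrib)
    qed
    have Rd: "R ^ d = Q ^ d * \<epsilon> powr (- 1 / (1 / 2 + 1 / real d)) * L"
    proof -
      have "- 2 * real d / (real d + 2) = - 1 / (1 / 2 + 1 / real d)" using d1 by (simp add: field_simps)
      then show ?thesis unfolding pow using d1 L by simp
    qed
    \<comment> \<open>For \<open>m \<ge> d\<close> at least one factor \<open>L\<close> and one
      factor \<open>Q\<close> survive; only \<open>m = d + 1\<close> and \<open>m = d + 2\<close>
      are needed.\<close>
    have lower: "Q * (1 / \<epsilon>) powr s * L \<le> R ^ m" if "d \<le> m" "s \<le> 2 * real m / (real d + 2)" for m and s :: real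
    proof -
      have "Q ^ 1 \<le> Q ^ m" using that(1) d0 Q by (intro power_increasing) auto
      moreover have "(1 / \<epsilon>) powr s \<le> \<epsilon> powr (- 2 * real m / (real d + 2))"
      proof -
        have "(1 / \<epsilon>) powr s \<le> (1 / \<epsilon>) powr (2 * real m / (real d + 2))"
          using \<epsilon> that(2) by (intro powr_mono) auto
        also have "\<dots> = \<epsilon> powr (- 2 * real m / (real d + 2))"
          using \<epsilon> by (simp add: powr_divide powr_minus_divide)
        finally show ?thesis .
      qed
      moreover have "L powr 1 \<le> L powr (real m / real d)"
        using L that(1) d1 by (intro powr_mono) (auto simp: field_simps)
      ultimately show ?thesis
        unfolding pow using Q L by (intro mult_mono) auto
    qed
    have R1: "Q * (1 / \<epsilon>) * L \<le> R ^ (d + 1)"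
      using lower[of "d + 1" 1] d1 \<epsilon> by (simp add: field_simps)
    have R2: "Q * (1 / \<epsilon>)\<^sup>2 * L \<le> R ^ (d + 2)"
      using lower[of "d + 2" 2] d1 \<epsilon> by (simp add: field_simps)
    \<comment> \<open>Turns the grid term \<open>H * L / lam\<close> into exactly
      \<open>\<epsilon> / 16\<close>.\<close>
    define lam where "lam = 16 * H * L / \<epsilon>"
    have lam: "0 < lam" using H L \<epsilon> by (simp add: lam_def)
    define n where "n = nat \<lceil>24 * pi * A * real d / \<epsilon>\<rceil>"
    have n: "24 * pi * A * real d / \<epsilon> \<le> real n" unfolding n_def by linarith
    have t0: "0 < 24 * pi * A * real d / \<epsilon>" using A d1 \<epsilon> by simp
    have n0: "0 < n" using n t0 by linarith
    have n_le: "real n + 1 \<le> M / \<epsilon>"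
    proof -
      have "real n + 1 \<le> 24 * pi * A * real d / \<epsilon> + 2" using t0 unfolding n_def by linarith
      also have "\<dots> \<le> 24 * pi * A * real d / \<epsilon> + 2 / \<epsilon>" using \<epsilon> by (simp add: field_simps)
      finally show ?thesis by (simp add: M_def add_divide_distrib)
    qed
    have ln_le: "ln (4 * (real n + 1) ^ d) \<le> H * L"
    proof -
      have "ln (4 * (real n + 1) ^ d) = ln 4 + real d * ln (real n + 1)"
        by (simp add: ln_mult ln_realpow)
      also have "ln (real n + 1) \<le> ln (M / \<epsilon>)" using n_le by (intro ln_mono) auto
      also have "ln (M / \<epsilon>) = ln M + (L - 1)" using M \<epsilon> by (simp add: ln_div L_def)
      finally have "ln (4 * (real n + 1) ^ d) \<le> ln 4 * 1 + real d * ln M * 1 + real d * (L - 1)"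
        using d1 by (simp add: algebra_simps)
      also have "\<dots> \<le> ln 4 * L + real d * ln M * L + real d * L"
        using L M by (intro add_mono mult_left_mono) auto
      finally show ?thesis by (simp add: H_def algebra_simps)
    qed
    have "real (card N) \<le> exp (C0 * \<epsilon> powr (- 1 / (1 / 2 + 1 / real d)) * L)"
      if N: "finite N" "packing_set (general_barron C) Linf_dist \<epsilon> N" for N :: "(real ^ 'n \<Rightarrow> real) set"
    proof -
      have "real (card N) \<le> exp ((2 * A + 8 * B * laplace_const d) * R ^ d)"
      proof (rule card_separated_le[OF assms \<epsilon>(1) R n0 lam, where N = N, folded d_def, folded A_def B_def])
        show "6 * pi * A * (real d / real n) \<le> \<epsilon> / 4" using n n0 \<epsilon> by (simp add: field_simps)
        have "lam \<le> Q * (1 / \<epsilon>) * L"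
          unfolding lam_def using mult_right_mono[OF Q(2), of "L / \<epsilon>"] L \<epsilon> by simp
        then show "lam \<le> R ^ (d + 1)" using R1 by linarith
        have "ln (4 * (real n + 1) ^ d) / lam \<le> H * L / lam"
          using ln_le lam by (intro divide_right_mono) auto
        also have "\<dots> = \<epsilon> / 16" using H L \<epsilon> by (simp add: lam_def)
        finally have 1: "ln (4 * (real n + 1) ^ d) / lam \<le> \<epsilon> / 16" .
        have "(B + A) / R ^ (d + 2) \<le> (B + A) / (Q * (1 / \<epsilon>)\<^sup>2 * L)"
          using R2 R A B Q L \<epsilon> by (intro divide_left_mono mult_pos_pos zero_less_power) auto
        then have "2 * lam * ((B + A) / R ^ (d + 2)) \<le> 2 * lam * ((B + A) / (Q * (1 / \<epsilon>)\<^sup>2 * L))"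
          using lam by (intro mult_left_mono) auto
        also have "\<dots> = 512 * H * (B + A) / Q * (\<epsilon> / 16)"
          using Q(1) L \<epsilon> by (simp add: lam_def power2_eq_square field_simps)
        also have "\<dots> \<le> 1 * (\<epsilon> / 16)"
          using Q \<epsilon> by (intro mult_right_mono) auto
        finally have "2 * lam * ((B + A) / R ^ (d + 2)) \<le> \<epsilon> / 16" by simp
        then show "ln (4 * (real n + 1) ^ d) / lam + 2 * lam * ((B + A) / R ^ (d + 2)) \<le> \<epsilon> / 8"
          using 1 by linarith
        show "finite N" "N \<subseteq> general_barron C" using N by (auto simp: packing_set_def)
        show "ereal \<epsilon> < Linf_dist f g" if "f \<in> N" "g \<in> N" "f \<noteq> g" for f g
          using N(2) that by (auto simp: packing_set_def)
      qed
      then show ?thesis unfolding Rd C0_def by (simp add: mult_ac)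
    qed
    then show ?thesis
      unfolding L_def[symmetric]
      using C0 L \<epsilon> by (intro packing_entropy_le) auto
  qed
  then show ?thesis unfolding d_def using C0 by blast
qed

end
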